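(* $p(K_{3,1,1},\cdot)$ is perfectly stable, $i(K_{3,1,1})=\frac{216}{625}$, and the unique maximiser is $(\frac35,0,\ldots)$.
   Context: $K_{3,1,1}$ is the complete $3$-partite graph with parts of sizes $3,1,1$. For graphs $F,G$ with $v(F)\le v(G)$, $P(F,G)$ is the number of $v(F)$-subsets of $V(G)$ inducing a copy of $F$, and $p(F,G)=P(F,G)/\binom{v(G)}{v(F)}$. $i(F,n)=\max\{P(F,G):v(G)=n\}$ and $i(F)=\lim_{n\to\infty}i(F,n)/\binom{n}{v(F)}$. Write $\lambda=p(F,\cdot)$, $\lambda(n)=\max\{\lambda(G):v(G)=n\}$, $\lambda_{\max}=\lim_n\lambda(n)$. A graph is complete partite if its vertex set is partitioned into independent sets (parts) with all edges between distinct parts. For $n$-vertex graphs $G,H$, $\hat\delta_1(G,H)=\frac2{n^2}\min_\sigma|E(H)\triangle E(\sigma(G))|$ over bijections $\sigma:V(G)\to V(H)$. $\lambda$ is perfectly stable if there is $C>0$ such that every graph $G$ of order $n\ge C$ admits a complete partite $H$ of order $n$ with $\hat\delta_1(G,H)\le C(\lambda(n)-\lambda(G))$. A maximiser is a sequence $\mathbf x=(x_1,x_2,\ldots)$ with $x_1\ge x_2\ge\cdots\ge0$, $\sum x_i\le1$, for which there are complete partite graphs $H_n$ with $v(H_n)\to\infty$, $\lambda(H_n)\to\lambda_{\max}$, and the $i$-th largest part of $H_n$ having $(x_i+o(1))v(H_n)$ vertices for every $i\ge1$ (so $(\frac35,0,\ldots)$ corresponds to an independent set of proportion $\frac35$ with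 all remaining vertices universal). "Unique maximiser" means the set of maximisers consists of exactly this sequence. *)

theory Defs
  imports Complex_Main "HOL-Library.Disjoint_Sets" "HOL-Library.Multiset"
begin

text \<open>A graph is a pair of a vertex set and a set of edges, each edge a two-element vertex set.
  Vertices are natural numbers; every finite graph is isomorphic to such a graph, and all
  notions below are invariant under isomorphism.\<close>

type_synonym graph = "nat set \<times> nat set set"

abbreviation verts :: "graph \<Rightarrow> nat set" where
  "verts \<equiv> fst"

abbreviation edges :: "graph \<Rightarrow> nat set set" where
  "edges \<equiv> snd"

definition is_graph :: "graph \<Rightarrow> bool" where
  "is_graph G \<longleftrightarrow> finite (verts G) \<and> (\<forall>e\<in>edges G. e \<subseteq> verts G \<and> card e = 2)"

definition num_verts :: "graph \<Rightarrow> nat" where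
  "num_verts G = card (verts G)"

definition graphs_of_order :: "nat \<Rightarrow> graph set" where
  "graphs_of_order n = {G. is_graph G \<and> num_verts G = n}"

definition induced :: "graph \<Rightarrow> nat set \<Rightarrow> graph" where
  "induced G S = (S, {e \<in> edges G. e \<subseteq> S})"

definition graph_iso :: "graph \<Rightarrow> graph \<Rightarrow> bool" where
  "graph_iso F G \<longleftrightarrow> (\<exists>f. bij_betw f (verts F) (verts G) \<and> edges G = (`) f ` edges F)"

definition induced_count :: "graph \<Rightarrow> graph \<Rightarrow> nat" where
  "induced_count F G =
     card {S. S \<subseteq> verts G \<and> card S = num_verts F \<and> graph_iso F (induced G S)}"

text \<open>The density is only meaningful for \<open>num_verts F \<le> num_verts G\<close>; otherwise it is \<open>0\<close>.\<close>

definition induced_density :: "graph \<Rightarrow> graph \<Rightarrow> real" where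
  "induced_density F G =
     real (induced_count F G) / real (num_verts G choose num_verts F)"

definition max_induced_count :: "graph \<Rightarrow> nat \<Rightarrow> nat" where
  "max_induced_count F n = Max (induced_count F ` graphs_of_order n)"

definition inducibility :: "graph \<Rightarrow> real" where
  "inducibility F = lim (\<lambda>n. real (max_induced_count F n) / real (n choose num_verts F))"

definition param_max :: "(graph \<Rightarrow> real) \<Rightarrow> nat \<Rightarrow> real" where
  "param_max \<Lambda> n = Max (\<Lambda> ` graphs_of_order n)"

definition param_lim :: "(graph \<Rightarrow> real) \<Rightarrow> real" where
  "param_lim \<Lambda> = lim (param_max \<Lambda>)"

definition complete_partite_graph :: "nat set set \<Rightarrow> graph" where
  "complete_partite_graph \<P> =
     (\<Union>\<P>, {{u, v} | u v. \<exists>A\<in>\<P>. \<exists>B\<in>\<P>. A \<noteq> B \<and> u \<in> A \<and> v \<in> B})"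

definition has_parts :: "graph \<Rightarrow> nat set set \<Rightarrow> bool" where
  "has_parts G \<P> \<longleftrightarrow> partition_on (verts G) \<P> \<and> G = complete_partite_graph \<P>"

definition complete_partite :: "graph \<Rightarrow> bool" where
  "complete_partite G \<longleftrightarrow> (\<exists>\<P>. has_parts G \<P>)"

definition K311 :: graph where
  "K311 = complete_partite_graph {{0, 1, 2}, {3}, {4}}"

text \<open>Normalised edit distance, used for graphs of equal order only. The set under \<open>Min\<close> is
  finite, since it consists of natural numbers at most
  \<open>card (edges G) + card (edges H)\<close>.\<close>

definition edit_dist :: "graph \<Rightarrow> graph \<Rightarrow> real" where
  "edit_dist G H = 2 / real (num_verts G) ^ 2 *
     real (Min {card (sym_diff (edges H) ((`) \<sigma> ` edges G)) | \<sigma>.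
                  bij_betw \<sigma> (verts G) (verts H)})"

definition perfectly_stable :: "(graph \<Rightarrow> real) \<Rightarrow> bool" where
  "perfectly_stable \<Lambda> \<longleftrightarrow>
     (\<exists>C::real. C > 0 \<and>
        (\<forall>n. real n \<ge> C \<longrightarrow>
           (\<forall>G\<in>graphs_of_order n. \<exists>H\<in>graphs_of_order n.
              complete_partite H \<and> edit_dist G H \<le> C * (param_max \<Lambda> n - \<Lambda> G))))"

text \<open>Size of the \<open>(i + 1)\<close>-st largest part (counted with multiplicity), and \<open>0\<close> if there are
  at most \<open>i\<close> parts. Accordingly, the entry \<open>x i\<close> of a sequence below is the \<open>(i + 1)\<close>-st term
  in the usual numbering from \<open>1\<close>.\<close>

definition part_size :: "nat set set \<Rightarrow> nat \<Rightarrow> nat" where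
  "part_size \<P> i =
     (let s = rev (sorted_list_of_multiset (image_mset card (mset_set \<P>)))
      in if i < length s then s ! i else 0)"

definition maximiser :: "(graph \<Rightarrow> real) \<Rightarrow> (nat \<Rightarrow> real) \<Rightarrow> bool" where
  "maximiser \<Lambda> x \<longleftrightarrow>
     decseq x \<and> (\<forall>i. x i \<ge> 0) \<and> summable x \<and> suminf x \<le> 1 \<and>
     (\<exists>H \<P>. (\<forall>n. is_graph (H n) \<and> has_parts (H n) (\<P> n)) \<and>
        filterlim (\<lambda>n. num_verts (H n)) at_top sequentially \<and>
        (\<lambda>n. \<Lambda> (H n)) \<longlonglongrightarrow> param_lim \<Lambda> \<and>
        (\<forall>i. (\<lambda>n. real (part_size (\<P> n) i) / real (num_verts (H n))) \<longlonglongrightarrow> x i))"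

end

theory Submission imports Defs begin

text \<open>Work with the complement relation \<open>R\<close> of a graph, made reflexive: a copy of \<open>K311\<close> is an
  \<open>R\<close>-clique \<open>T\<close> of size 3 together with a pair \<open>U\<close> of vertices that are isolated in \<open>T \<union> U\<close>.
  Zykov symmetrisation, one vertex at a time, never lowers the number of copies and ends in an
  equivalence relation. For an equivalence relation with class proportions \<open>x\<^sub>i\<close> the density is, up to \<open>o(1)\<close>, at
  most \<open>10 (\<Sum> x\<^sub>i\<^sup>3 (1 - 2 x\<^sub>i + 2 x\<^sub>i\<^sup>2 - q))\<close> with \<open>q = \<Sum> x\<^sub>i\<^sup>2\<close>, and an elementary argument shows
  that this is at most \<open>216/625\<close>, with equality only for \<open>(3/5, 0, ...)\<close>, in a stable form.

  For perfect stability, suppose that \<open>R\<close> differs in at most \<open>\<epsilon> n\<^sup>2\<close> pairs from a clique on \<open>X\<close> plus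
  isolated vertices, with \<open>X\<close> chosen optimally. Correcting all wrong pairs at a vertex with the largest
  number \<open>d\<close> of wrong pairs gains at least a constant times \<open>d n\<^sup>3\<close> copies, so the number of copies
  lost by \<open>R\<close> is linear in the number of wrong pairs. In particular an almost extremal \<open>R\<close> is much
  closer to the clique than \<open>\<epsilon> n\<^sup>2\<close>. As a symmetrisation step changes at most \<open>2 n\<close> pairs, closeness
  therefore propagates backwards from the final equivalence relation to the original \<open>R\<close>.\<close>

subsection \<open>Copies in the complement relation\<close>

text \<open>Symmetrisation works because \<open>K311\<close> is itself complete partite: two related
  vertices of a copy both lie in \<open>T\<close> and are indistinguishable inside the copy.

  The value 3/5 maximises y^3 (1 - y)^2. The maximum 108/3125, divided by 3! 2! = 12, bounds the
  number of copies by 9/3125 n^5, and 120 * 9/3125 = 216/625.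

  Two obstacles shape the stability proof. At proportion 3/5 a clique vertex and an isolated vertex
  lie in asymptotically equally many copies, so correcting a vertex gains nothing unless the vertex
  is already nearer to its own type than to the other; this is what the optimal choice of
  \<open>X\<close> secures. Moreover, the number of symmetrisation steps is not controlled, so the
  errors of the steps cannot be summed. Instead a window (n/4000)^2 for the number of wrong pairs
  improves itself: a relation inside it with at least (9/3125 - 1/10^11) n^5 copies has at most half
  that many wrong pairs, and the other half has room for one more step. The deficit 1/10^11 is what
  the loss of n^3/2000 copies per wrong pair requires for the halving.\<close>

definition copies :: "('a \<Rightarrow> 'a \<Rightarrow> bool) \<Rightarrow> 'a set \<Rightarrow> ('a set \<times> 'a set) set" where
  "copies R V = {(T, U). T \<subseteq> V \<and> U \<subseteq> V \<and> card T = 3 \<and> card U = 2 \<and> T \<inter> U = {} \<and>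
     (\<forall>x\<in>T. \<forall>y\<in>T. R x y) \<and> (\<forall>u\<in>U. \<forall>w\<in>T \<union> U. w \<noteq> u \<longrightarrow> \<not> R u w)}"

lemma copiesD:
  assumes "(T, U) \<in> copies R V"
  shows "T \<subseteq> V" "U \<subseteq> V" "card T = 3" "card U = 2" "T \<inter> U = {}" "finite T" "finite U"
    "\<And>x y. x \<in> T \<Longrightarrow> y \<in> T \<Longrightarrow> R x y"
    "\<And>u w. u \<in> U \<Longrightarrow> w \<in> T \<union> U \<Longrightarrow> w \<noteq> u \<Longrightarrow> \<not> R u w"
proof -
  show "T \<subseteq> V" "U \<subseteq> V" "card T = 3" "card U = 2" "T \<inter> U = {}" 
    "\<And>x y. x \<in> T \<Longrightarrow> y \<in> T \<Longrightarrow> R x y"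
    "\<And>u w. u \<in> U \<Longrightarrow> w \<in> T \<union> U \<Longrightarrow> w \<noteq> u \<Longrightarrow> \<not> R u w"
    using assms by (auto simp: copies_def)
  then show "finite T" "finite U"
    by (auto intro: card_ge_0_finite)
qed

lemma card_Un_copies:
  assumes "(T, U) \<in> copies R V"
  shows "card (T \<union> U) = 5"
  using copiesD[OF assms] by (simp add: card_Un_disjoint)

lemma finite_copies: "finite V \<Longrightarrow> finite (copies R V)"
  by (rule finite_subset[of _ "Pow V \<times> Pow V"]) (auto simp: copies_def)

text \<open>In the union, \<open>T\<close> consists of the vertices related to another vertex and
  \<open>U\<close> of those related to no other. Copies can therefore be counted by their vertex
  sets, and error terms by families of 5-sets.\<close>

lemma inj_on_copies: "inj_on (\<lambda>(T, U). T \<union> U) (copies R V)"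
proof -
  have sub: "T \<subseteq> T'"
    if 1: "(T, U) \<in> copies R V" and 2: "(T', U') \<in> copies R V" and eq: "T \<union> U = T' \<union> U'"
    for T U T' U' :: "'a set"
  proof
    fix x assume x: "x \<in> T"
    have "card (T - {x}) = 2" using x copiesD(3)[OF 1] by simp
    then obtain y where y: "y \<in> T" "y \<noteq> x" by (metis card_eq_0_iff all_not_in_conv Diff_iff insertI1 zero_neq_numeral)
    have "R x y" using copiesD(8)[OF 1] x y by blast
    then have "x \<notin> U'" using copiesD(9)[OF 2, of x y] eq y by blast
    then show "x \<in> T'" using x eq by blast
  qed
  show ?thesis
  proof (rule inj_onI, clarsimp)
    fix T U T' U' :: "'a set"
    assume 1: "(T, U) \<in> copies R V" and 2: "(T', U') \<in> copies R V" and eq: "T \<union> U = T' \<union> U'"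
    have "T = T'" using sub[OF 1 2 eq] sub[OF 2 1 eq[symmetric]] by blast
    moreover have "U = (T \<union> U) - T" "U' = (T' \<union> U') - T'"
      using copiesD(5)[OF 1] copiesD(5)[OF 2] by auto
    ultimately show "T = T' \<and> U = U'" using eq by metis
  qed
qed

lemma copies_cong:
  assumes "\<And>x y. x \<in> T \<union> U \<Longrightarrow> y \<in> T \<union> U \<Longrightarrow> R x y = R' x y"
  shows "(T, U) \<in> copies R V \<longleftrightarrow> (T, U) \<in> copies R' V"
proof -
  have "(\<forall>x\<in>T. \<forall>y\<in>T. R x y) = (\<forall>x\<in>T. \<forall>y\<in>T. R' x y)" using assms by blast
  moreover have "(\<forall>u\<in>U. \<forall>w\<in>T \<union> U. w \<noteq> u \<longrightarrow> \<not> R u w) = (\<forall>u\<in>U. \<forall>w\<in>T \<union> U. w \<noteq> u \<longrightarrow> \<not> R' u w)"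
    using assms by blast
  ultimately show ?thesis unfolding copies_def by simp
qed

lemma copies_cong_on:
  assumes "\<And>x y. x \<in> V \<Longrightarrow> y \<in> V \<Longrightarrow> R x y = R' x y"
  shows "copies R V = copies R' V"
proof -
  have "(T, U) \<in> copies R V \<longleftrightarrow> (T, U) \<in> copies R' V" for T U
  proof (cases "T \<union> U \<subseteq> V")
    case True
    then show ?thesis using assms by (intro copies_cong) auto
  qed (auto dest: copiesD(1,2))
  then show ?thesis by auto
qed

section \<open>Comparing the copies of two relations\<close>

lemma card_copies_outside_le:
  assumes "finite V"
    and "\<And>T U. (T, U) \<in> copies R V \<Longrightarrow> (T, U) \<notin> \<G> \<Longrightarrow> T \<union> U \<in> \<S>"
    and "finite \<S>"
  shows "card (copies R V - \<G>) \<le> card \<S>"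
proof (rule card_inj_on_le)
  show "inj_on (\<lambda>(T, U). T \<union> U) (copies R V - \<G>)"
    by (rule inj_on_subset[OF inj_on_copies]) auto
  show "(\<lambda>(T, U). T \<union> U) ` (copies R V - \<G>) \<subseteq> \<S>" using assms(2) by auto
qed fact

lemma card_copies_le_add_disagree:
  assumes "finite V"
  shows "card (copies R V) \<le> card (copies R' V) +
    card {S. S \<subseteq> V \<and> card S = 5 \<and> (\<exists>x\<in>S. \<exists>y\<in>S. R x y \<noteq> R' x y)}"
    (is "_ \<le> _ + card ?S")
proof -
  have fS: "finite ?S" by (rule finite_subset[of _ "Pow V"]) (use assms in auto)
  have "card (copies R V - copies R' V) \<le> card ?S"
  proof (rule card_copies_outside_le[OF assms _ fS])
    fix T U assume 1: "(T, U) \<in> copies R V" and 2: "(T, U) \<notin> copies R' V"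
    then have "\<exists>x\<in>T \<union> U. \<exists>y\<in>T \<union> U. R x y \<noteq> R' x y"
      using copies_cong[of T U R R' V] by blast
    then show "T \<union> U \<in> ?S" using card_Un_copies[OF 1] copiesD(1,2)[OF 1] by auto
  qed
  moreover have "card (copies R V) \<le> card (copies R' V) + card (copies R V - copies R' V)"
    by (metis Un_Diff_cancel Un_upper2 assms card_Un_le card_mono finite_Diff finite_UnI finite_copies le_trans)
  ultimately show ?thesis by linarith
qed

lemma card_image_tuples_le:
  "finite A \<Longrightarrow> card A \<le> k \<Longrightarrow> S \<subseteq> f ` A \<Longrightarrow> card S \<le> k"
  by (meson card_image_le card_mono finite_imageI le_trans)

text \<open>Both relations are reflexive, so a disagreement involves two distinct vertices, and
  three free vertices complete the 5-set.\<close>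

lemma card_disagree_le:
  assumes V: "finite V" and r: "\<And>x. R x x" "\<And>x. R' x x"
  shows "card {S. S \<subseteq> V \<and> card S = 5 \<and> (\<exists>x\<in>S. \<exists>y\<in>S. R x y \<noteq> R' x y)}
    \<le> card {(x, y). x \<in> V \<and> y \<in> V \<and> R x y \<noteq> R' x y} * card V ^ 3"
    (is "card ?S \<le> card ?B * _")
proof (rule card_image_tuples_le[of "?B \<times> V \<times> V \<times> V"])
  have fB: "finite ?B" by (rule finite_subset[of _ "V \<times> V"]) (use V in auto)
  show "finite (?B \<times> V \<times> V \<times> V)" using fB V by simp
  show "card (?B \<times> V \<times> V \<times> V) \<le> card ?B * card V ^ 3"
    by (simp add: card_cartesian_product power3_eq_cube mult_ac)
  show "?S \<subseteq> (\<lambda>((x, y), z1, z2, z3). {x, y, z1, z2, z3}) ` (?B \<times> V \<times> V \<times> V)"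
  proof
    fix S assume "S \<in> ?S"
    then obtain x y where S: "S \<subseteq> V" "card S = 5" and xy: "x \<in> S" "y \<in> S" "R x y \<noteq> R' x y" by blast
    have "x \<noteq> y" using xy r by auto
    then have "card (S - {x, y}) = 3"
      using S xy by (subst card_Diff_subset) auto
    then obtain z1 z2 z3 where z: "S - {x, y} = {z1, z2, z3}" by (auto simp: card_3_iff)
    then have "S = {x, y, z1, z2, z3}" using xy by auto
    moreover have "((x, y), z1, z2, z3) \<in> ?B \<times> V \<times> V \<times> V" using xy S z by blast
    ultimately show "S \<in> (\<lambda>((x, y), z1, z2, z3). {x, y, z1, z2, z3}) ` (?B \<times> V \<times> V \<times> V)"
      by (intro image_eqI[of _ _ "((x, y), z1, z2, z3)"]) auto
  qed
qed

subsection \<open>Symmetrisation\<close>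

text \<open>Substituting \<open>v\<close> for \<open>u\<close> in both arguments also relates
  \<open>u\<close> to \<open>v\<close> and to itself, because \<open>R v v\<close> holds for a
  reflexive \<open>R\<close>.\<close>

definition clone :: "('a \<Rightarrow> 'a \<Rightarrow> bool) \<Rightarrow> 'a \<Rightarrow> 'a \<Rightarrow> 'a \<Rightarrow> 'a \<Rightarrow> bool" where
  "clone R u v x y = R (if x = u then v else x) (if y = u then v else y)"

definition twins :: "('a \<Rightarrow> 'a \<Rightarrow> bool) \<Rightarrow> 'a set \<Rightarrow> ('a \<times> 'a) set" where
  "twins R V = {(x, y). x \<in> V \<and> y \<in> V \<and> (\<forall>w\<in>V. R x w = R y w)}"

text \<open>Copies containing neither or both of \<open>u\<close>, \<open>v\<close> survive; in the
  second case both vertices lie in \<open>T\<close> and are related to the same vertices of the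
  copy. Copies with \<open>v\<close> alone survive and acquire a duplicate with \<open>u\<close> in
  place of \<open>v\<close>. Only copies with \<open>u\<close> alone may be lost.\<close>

lemma card_copies_clone:
  assumes V: "finite V" and uv: "u \<in> V" "v \<in> V" "u \<noteq> v" "R u v"
    and sym: "\<And>x y. R x y \<longleftrightarrow> R y x" and refl: "\<And>x. R x x"
  shows "card (copies R V) + card {(T, U) \<in> copies R V. u \<notin> T \<union> U \<and> v \<in> T \<union> U}
    \<le> card (copies (clone R u v) V) + card {(T, U) \<in> copies R V. u \<in> T \<union> U \<and> v \<notin> T \<union> U}"
    (is "_ + card ?Kv \<le> card ?C + card ?Ku")
proof -
  define g where "g x = (if x = v then u else x)" for x
  define \<phi> where "\<phi> = (\<lambda>(T, U). (g ` T, g ` U))"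
  have inj: "inj_on g S" if "u \<notin> S" for S
    using that by (auto simp: inj_on_def g_def)
  have fin: "finite (copies R V)" "finite ?C" using V by (auto intro: finite_copies)
  have sub1: "copies R V - ?Ku \<subseteq> ?C"
  proof (rule subrelI)
    fix T U assume "(T, U) \<in> copies R V - ?Ku"
    then have TU: "(T, U) \<in> copies R V"
      and *: "u \<in> T \<union> U \<Longrightarrow> v \<in> T \<union> U" by auto
    show "(T, U) \<in> ?C"
    proof (cases "u \<in> T \<union> U")
      case False
      then have "R x y = clone R u v x y" if "x \<in> T \<union> U" "y \<in> T \<union> U" for x y
        using that by (auto simp: clone_def)
      then show ?thesis using TU copies_cong[of T U R "clone R u v" V] by auto
    next
      case True
      then have v: "v \<in> T \<union> U" using * by simp
      have uT: "u \<in> T" and vT: "v \<in> T"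
        using copiesD(9)[OF TU, of u v] copiesD(9)[OF TU, of v u] True v uv sym by blast+
      have eq: "R u y = R v y" if "y \<in> T \<union> U" for y
      proof (cases "y \<in> T")
        case True then show ?thesis using copiesD(8)[OF TU] uT vT by blast
      next
        case False
        then have "y \<in> U" "y \<noteq> u" "y \<noteq> v" using that uT vT by auto
        then show ?thesis
          using copiesD(9)[OF TU, of y u] copiesD(9)[OF TU, of y v] sym uT vT by blast
      qed
      have "R x y = clone R u v x y" if "x \<in> T \<union> U" "y \<in> T \<union> U" for x y
      proof -
        have "R x u = R x v" using eq[OF that(1)] sym by blast
        then show ?thesis using eq[OF that(2)] refl uv by (auto simp: clone_def)
      qed
      then show ?thesis using TU copies_cong[of T U R "clone R u v" V] by auto
    qed
  qed
  have sub2: "\<phi> ` ?Kv \<subseteq> ?C"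
  proof (clarsimp simp: \<phi>_def)
    fix T U assume TU: "(T, U) \<in> copies R V" and u: "u \<notin> T" "u \<notin> U"
    have cl: "clone R u v (g x) (g y) = R x y" if "x \<in> T \<union> U" "y \<in> T \<union> U" for x y
      using that u by (auto simp: clone_def g_def)
    note D = copiesD[OF TU]
    have "card (g ` T) = 3" "card (g ` U) = 2"
      using card_image[OF inj, of T] card_image[OF inj, of U] u D(3,4) by auto
    moreover have "g ` T \<subseteq> V" "g ` U \<subseteq> V" using D(1,2) uv by (auto simp: g_def)
    moreover have "g ` T \<inter> g ` U = {}" using D(5) u by (auto simp: g_def split: if_splits)
    moreover have "\<forall>x\<in>g ` T. \<forall>y\<in>g ` T. clone R u v x y" using D(8) cl by auto
    moreover have "\<forall>x\<in>g ` U. \<forall>y\<in>g ` T \<union> g ` U. y \<noteq> x \<longrightarrow> \<not> clone R u v x y"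
    proof (intro ballI impI)
      fix x y assume "x \<in> g ` U" "y \<in> g ` T \<union> g ` U" "y \<noteq> x"
      then obtain x' y' where "x' \<in> U" "y' \<in> T \<union> U" "x = g x'" "y = g y'" "y' \<noteq> x'" by blast
      then show "\<not> clone R u v x y" using D(9)[of x' y'] cl[of x' y'] by simp
    qed
    ultimately show "(g ` T, g ` U) \<in> ?C" unfolding copies_def by simp
  qed
  have injphi: "inj_on \<phi> ?Kv"
  proof (rule inj_onI, clarsimp simp: \<phi>_def)
    fix T U T' U' assume u: "u \<notin> T" "u \<notin> U" "u \<notin> T'" "u \<notin> U'"
      and eq: "g ` T = g ` T'" "g ` U = g ` U'"
    have "inj_on g (- {u})" using inj by auto
    from inj_on_image_eq_iff[OF this, of T T'] inj_on_image_eq_iff[OF this, of U U']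
    show "T = T' \<and> U = U'" using u eq by auto
  qed
  have disj: "(copies R V - ?Ku) \<inter> \<phi> ` ?Kv = {}"
    using uv by (auto simp: \<phi>_def g_def split: if_splits)
  have finK: "finite ?Kv" "finite ?Ku" using fin(1) by (auto elim: finite_subset[rotated])
  have "card (copies R V - ?Ku) + card ?Kv = card ((copies R V - ?Ku) \<union> \<phi> ` ?Kv)"
    using card_Un_disjoint[OF _ _ disj] fin(1) finK card_image[OF injphi] by simp
  also have "\<dots> \<le> card ?C"
    using sub1 sub2 fin(2) by (intro card_mono) auto
  finally have "card (copies R V - ?Ku) + card ?Kv \<le> card ?C" .
  moreover have "card (copies R V - ?Ku) = card (copies R V) - card ?Ku" "card ?Ku \<le> card (copies R V)"
    using fin(1) finK by (auto intro!: card_Diff_subset card_mono)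
  ultimately show ?thesis by linarith
qed

text \<open>Twins other than \<open>u\<close> stay twins. The pairs involving \<open>u\<close>
  number \<open>2 * card (A u) - 1\<close> before and at least \<open>2 * card (A v) + 1\<close>
  after, since \<open>u\<close> joins the class of \<open>v\<close>.\<close>

lemma card_twins_clone_less:
  assumes V: "finite V" and uv: "u \<in> V" "v \<in> V" and nt: "(u, v) \<notin> twins R V"
    and sym: "\<And>x y. R x y \<longleftrightarrow> R y x"
    and le: "card {y. (u, y) \<in> twins R V} \<le> card {y. (v, y) \<in> twins R V}"
  shows "card (twins R V) < card (twins (clone R u v) V)"
proof -
  let ?t = "twins R V" and ?t' = "twins (clone R u v) V"
  define P where "P = {(x, y) \<in> ?t. x \<noteq> u \<and> y \<noteq> u}"
  define A where "A x = {y. (x, y) \<in> ?t}" for x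
  have fin: "finite (twins S V)" for S by (rule finite_subset[of _ "V \<times> V"]) (use V in \<open>auto simp: twins_def\<close>)
  have finA: "finite (A x)" for x by (rule finite_subset[OF _ V]) (auto simp: A_def twins_def)
  have finP: "finite P" by (rule finite_subset[OF _ fin[of R]]) (auto simp: P_def)
  have tsym: "(x, y) \<in> ?t \<longleftrightarrow> (y, x) \<in> ?t" for x y by (auto simp: twins_def)
  have uA: "u \<in> A u" using uv by (auto simp: A_def twins_def)
  have uAv: "u \<notin> A v" using nt tsym by (auto simp: A_def)
  have *: "clone R u v x w = R (if x = u then v else x) (if w = u then v else w)" for x w
    by (simp add: clone_def)
  have "?t \<subseteq> P \<union> ({u} \<times> A u \<union> (A u - {u}) \<times> {u})"
  proof (rule subrelI, rule ccontr)
    fix x y assume "(x, y) \<in> ?t" "(x, y) \<notin> P \<union> ({u} \<times> A u \<union> (A u - {u}) \<times> {u})"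
    then show False using tsym[of x u] by (auto simp: P_def A_def)
  qed
  then have "card ?t \<le> card (P \<union> ({u} \<times> A u \<union> (A u - {u}) \<times> {u}))"
    using finP finA by (intro card_mono) auto
  also have "\<dots> \<le> card P + card ({u} \<times> A u \<union> (A u - {u}) \<times> {u})"
    by (rule card_Un_le)
  also have "\<dots> \<le> card P + (card ({u} \<times> A u) + card ((A u - {u}) \<times> {u}))"
    by (intro add_left_mono card_Un_le)
  also have "\<dots> = card P + 2 * card (A u) - 1"
    using uA finA[of u] card_gt_0_iff[of "A u"] by (auto simp: card_cartesian_product)
  finally have 1: "card ?t \<le> card P + 2 * card (A u) - 1" .
  have "P \<union> (({u} \<times> insert u (A v)) \<union> A v \<times> {u}) \<subseteq> ?t'"
  proof -
    have "P \<subseteq> ?t'" using uv by (auto simp: P_def twins_def *)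
    moreover have "(u, y) \<in> ?t' \<and> (y, u) \<in> ?t'" if "y \<in> A v" for y
    proof -
      have "y \<noteq> u" using that uAv by auto
      then show ?thesis using that uv by (auto simp: A_def twins_def *)
    qed
    moreover have "(u, u) \<in> ?t'" using uv by (auto simp: twins_def)
    ultimately show ?thesis by blast
  qed
  then have "card (P \<union> (({u} \<times> insert u (A v)) \<union> A v \<times> {u})) \<le> card ?t'"
    using fin card_mono by blast
  also have "card (P \<union> (({u} \<times> insert u (A v)) \<union> A v \<times> {u}))
     = card P + (card ({u} \<times> insert u (A v)) + card (A v \<times> {u}))"
    using finP finA[of v] uAv
    by (subst card_Un_disjoint, simp, simp, force simp: P_def, subst card_Un_disjoint) auto
  also have "\<dots> = card P + 2 * card (A v) + 1"
    using finA[of v] uAv by (simp add: card_cartesian_product)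
  finally show ?thesis using 1 le by (simp add: A_def)
qed

text \<open>A failure \<open>R x y\<close>, \<open>R y z\<close>, \<open>\<not> R x z\<close> of
  transitivity yields related vertices \<open>x\<close>, \<open>y\<close> that are not twins. Of the
  two directions, cloning goes towards the vertex lying in more copies without the other, and in a
  tie towards the larger twin class.\<close>

lemma symmetrisation_step:
  assumes V: "finite V" and sym: "\<And>x y. R x y \<longleftrightarrow> R y x" and refl: "\<And>x. R x x"
    and nontrans: "\<not> (\<forall>x\<in>V. \<forall>y\<in>V. \<forall>z\<in>V. R x y \<longrightarrow> R y z \<longrightarrow> R x z)"
  obtains u v where "u \<in> V" "v \<in> V"
    "card (copies R V) < card (copies (clone R u v) V) \<or>
     card (copies R V) = card (copies (clone R u v) V) \<and>
     card (twins R V) < card (twins (clone R u v) V)"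
proof -
  obtain x y z where xyz: "x \<in> V" "y \<in> V" "z \<in> V" "R x y" "R y z" "\<not> R x z" using nontrans by blast
  then have nt: "(x, y) \<notin> twins R V" "x \<noteq> y" by (auto simp: twins_def)
  define K where "K u v = card {(T, U) \<in> copies R V. u \<notin> T \<union> U \<and> v \<in> T \<union> U}" for u v
  define t where "t u = card {w. (u, w) \<in> twins R V}" for u
  have "\<exists>u v. {u, v} = {x, y} \<and> (K v u < K u v \<or> K v u = K u v \<and> t u \<le> t v)"
  proof (cases "K y x < K x y \<or> K y x = K x y \<and> t x \<le> t y")
    case True
    then show ?thesis by blast
  next
    case False
    then have "K x y < K y x \<or> K x y = K y x \<and> t y \<le> t x" by linarith
    then show ?thesis by (intro exI[of _ y] exI[of _ x]) auto
  qed
  then obtain u v where uv: "{u, v} = {x, y}" "K v u < K u v \<or> K v u = K u v \<and> t u \<le> t v" by blast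
  have uv2: "u \<in> V" "v \<in> V" "u \<noteq> v" "R u v" "(u, v) \<notin> twins R V"
    using uv(1) xyz nt sym by (auto simp: doubleton_eq_iff twins_def)
  have "card (copies R V) + K u v \<le> card (copies (clone R u v) V) + K v u"
    using card_copies_clone[OF V uv2(1-4) sym refl] unfolding K_def by (simp add: conj_commute)
  moreover have "t u \<le> t v \<Longrightarrow> card (twins R V) < card (twins (clone R u v) V)"
    using card_twins_clone_less[OF V uv2(1,2,5) sym] unfolding t_def by blast
  ultimately show ?thesis using that[OF uv2(1,2)] uv(2) by linarith
qed

text \<open>The lexicographic potential (number of copies, number of pairs of twins) makes Zykov
  symmetrisation by single vertices terminate.\<close>

lemma symmetrisation_induct [consumes 3, case_names equivalence clone]:
  assumes V: "finite V" and sym: "\<And>x y. R x y \<longleftrightarrow> R y x" and refl: "\<And>x. R x x"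
    and equivalence: "\<And>R. \<lbrakk>\<And>x y. R x y \<longleftrightarrow> R y x; \<And>x. R x x;
      \<forall>x\<in>V. \<forall>y\<in>V. \<forall>z\<in>V. R x y \<longrightarrow> R y z \<longrightarrow> R x z\<rbrakk> \<Longrightarrow> P R"
    and clone: "\<And>R u v. \<lbrakk>\<And>x y. R x y \<longleftrightarrow> R y x; \<And>x. R x x; u \<in> V; v \<in> V;
      card (copies R V) \<le> card (copies (clone R u v) V); P (clone R u v)\<rbrakk> \<Longrightarrow> P R"
  shows "P R"
proof -
  define N where "N = card (Pow V \<times> Pow V)"
  define M where "M = card (V \<times> V)"
  have N: "card (copies R V) \<le> N" for R
    unfolding N_def by (rule card_mono) (use V in \<open>auto simp: copies_def\<close>)
  have M: "card (twins R V) \<le> M" for R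
    unfolding M_def by (rule card_mono) (use V in \<open>auto simp: twins_def\<close>)
  show ?thesis
    using sym refl
  proof (induction "(N - card (copies R V), M - card (twins R V))" arbitrary: R
      rule: wf_induct_rule[OF wf_lex_prod[OF wf_less_than wf_less_than]])
    case (1 R)
    show ?case
    proof (cases "\<forall>x\<in>V. \<forall>y\<in>V. \<forall>z\<in>V. R x y \<longrightarrow> R y z \<longrightarrow> R x z")
      case True
      then show ?thesis using equivalence 1(2,3) by blast
    next
      case False
      obtain u v where uv: "u \<in> V" "v \<in> V"
        and less: "card (copies R V) < card (copies (clone R u v) V) \<or>
         card (copies R V) = card (copies (clone R u v) V) \<and>
         card (twins R V) < card (twins (clone R u v) V)"
        by (rule symmetrisation_step[OF V 1(2,3) False])
      have "((N - card (copies (clone R u v) V), M - card (twins (clone R u v) V)),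
             (N - card (copies R V), M - card (twins R V))) \<in> less_than <*lex*> less_than"
        using less N[of R] N[of "clone R u v"] M[of R] M[of "clone R u v"] by auto
      then have "P (clone R u v)"
        using 1(2,3) by (intro 1(1)) (simp_all add: clone_def)
      then show ?thesis using clone[of R u v] 1(2,3) uv less by auto
    qed
  qed
qed

subsection \<open>Equivalence relations\<close>

text \<open>The left side has its maximum 108/3125 at 3/5. Divided by (y - 3/5)^2, the gap to the
  maximum is the cubic 12/125 + (8/25) y + y^2 (4/5 - y), and what follows its constant term is
  nonnegative on [0, 1].\<close>

lemma pow3_mult_sq_le:
  fixes y :: real
  assumes "0 \<le> y" "y \<le> 1"
  shows "y ^ 3 * (1 - y)\<^sup>2 \<le> 108 / 3125 - 12 / 125 * (y - 3 / 5)\<^sup>2"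
proof -
  have "y\<^sup>2 * (4 / 5 - y) \<ge> y\<^sup>2 * (- (1 / 5))"
    using assms by (intro mult_left_mono) auto
  moreover have "y\<^sup>2 \<le> y" using assms by (simp add: power2_eq_square mult_left_le)
  ultimately have "0 \<le> y\<^sup>2 * (4 / 5 - y) + 8 / 25 * y" using assms by linarith
  then have "0 \<le> (y - 3 / 5)\<^sup>2 * (y\<^sup>2 * (4 / 5 - y) + 8 / 25 * y)" by simp
  also have "\<dots> = 108 / 3125 - 12 / 125 * (y - 3 / 5)\<^sup>2 - y ^ 3 * (1 - y)\<^sup>2"
    by algebra
  finally show ?thesis by simp
qed

text \<open>For class proportions \<open>x\<close>, one twelfth of this is the leading coefficient
  of n^5 in the number of copies: the cube over 6 counts triples in the class \<open>A\<close>, the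
  bracket over 2 counts pairs from two different other classes.\<close>

definition part_poly :: "('b \<Rightarrow> real) \<Rightarrow> 'b set \<Rightarrow> real" where
  "part_poly x P = (\<Sum>A\<in>P. x A ^ 3 * ((1 - x A)\<^sup>2 - (\<Sum>B\<in>P - {A}. (x B)\<^sup>2)))"

text \<open>In this form the classes interact only through the total sum of squares, so each term
  can be estimated in two variables.\<close>

lemma part_poly_eq:
  assumes "finite P"
  shows "part_poly x P = (\<Sum>A\<in>P. x A ^ 3 * (1 - 2 * x A + 2 * (x A)\<^sup>2 - (\<Sum>B\<in>P. (x B)\<^sup>2)))"
  unfolding part_poly_def
proof (rule sum.cong[OF refl])
  fix A assume "A \<in> P"
  then have "(\<Sum>B\<in>P. (x B)\<^sup>2) = (x A)\<^sup>2 + (\<Sum>B\<in>P - {A}. (x B)\<^sup>2)"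
    using assms by (rule sum.remove[rotated])
  then show "x A ^ 3 * ((1 - x A)\<^sup>2 - (\<Sum>B\<in>P - {A}. (x B)\<^sup>2)) =
      x A ^ 3 * (1 - 2 * x A + 2 * (x A)\<^sup>2 - (\<Sum>B\<in>P. (x B)\<^sup>2))"
    by (simp add: power2_diff)
qed

text \<open>With q the sum of squares, the polynomial is a sum of terms \<open>x A\<^sup>2 * k (x A)\<close> where
  \<open>q * k t = t * q * (c - q) \<le> t * c\<^sup>2 / 4\<close>.\<close>

lemma part_poly_le_if_all_parts_le_half:
  assumes P: "finite P" and x: "\<And>A. A \<in> P \<Longrightarrow> 0 \<le> x A \<and> x A \<le> 1 / 2"
  shows "part_poly x P \<le> 1 / 32"
proof -
  define q where "q = (\<Sum>B\<in>P. (x B)\<^sup>2)"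
  have q0: "q \<ge> 0" unfolding q_def by (simp add: sum_nonneg)
  have k: "q * (t * (1 - 2 * t + 2 * t\<^sup>2 - q)) \<le> 1 / 32" if "0 \<le> t" "t \<le> 1 / 2" for t :: real
  proof -
    define c where "c = 1 - 2 * t + 2 * t\<^sup>2"
    \<comment> \<open>Now \<open>c = (1 + s\<^sup>2) / 2\<close>, and
      \<open>t * c\<^sup>2 \<le> 1 / 8\<close> becomes (1 - s) (1 + s^2)^2 \<le> 1, with equality at
      \<open>t = 1 / 2\<close>.\<close>
    define s where "s = 1 - 2 * t"
    have s: "0 \<le> s" "s \<le> 1" and t: "t = (1 - s) / 2" using that by (auto simp: s_def)
    have "0 \<le> s * ((1 - s)\<^sup>2 + s\<^sup>2 * (1 - s) + s\<^sup>2 * s\<^sup>2)" using s by simp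
    also have "\<dots> = 1 - 8 * (t * c\<^sup>2)" unfolding c_def t by (simp add: field_simps) algebra
    finally have "t * c\<^sup>2 \<le> 1 / 8" by simp
    moreover have "0 \<le> t * (c / 2 - q)\<^sup>2" using that by simp
    moreover have "q * (t * (c - q)) = t * c\<^sup>2 / 4 - t * (c / 2 - q)\<^sup>2"
      by (simp add: power2_eq_square field_simps)
    ultimately show ?thesis unfolding c_def by linarith
  qed
  show ?thesis
  proof (cases "q = 0")
    case True
    then have "x A = 0" if "A \<in> P" for A
      using that P unfolding q_def by (subst (asm) sum_nonneg_eq_0_iff) auto
    then show ?thesis unfolding part_poly_def by simp
  next
    case False
    have "q * part_poly x P = (\<Sum>A\<in>P. (x A)\<^sup>2 * (q * (x A * (1 - 2 * x A + 2 * (x A)\<^sup>2 - q))))"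
      unfolding part_poly_eq[OF P] q_def[symmetric] sum_distrib_left
      by (intro sum.cong refl) (simp add: power3_eq_cube power2_eq_square)
    also have "\<dots> \<le> (\<Sum>A\<in>P. (x A)\<^sup>2 * (1 / 32))"
      using k x by (intro sum_mono mult_left_mono) auto
    also have "\<dots> = q * (1 / 32)" by (simp add: q_def sum_divide_distrib)
    finally show ?thesis using q0 False by simp
  qed
qed

text \<open>A class \<open>A\<close> other than \<open>M\<close> adds at most 17/200 of
  \<open>(x A)\<^sup>2\<close> through its own triples, but lowers the term of \<open>M\<close> by
  \<open>x M ^ 3 * (x A)\<^sup>2\<close>, at least 1/8 of the same square. The net loss is 1/8 -
  17/200 = 1/25.\<close>

lemma part_poly_le_if_half_le:
  assumes P: "finite P" and x: "\<And>A. A \<in> P \<Longrightarrow> 0 \<le> x A" and sum1: "sum x P = 1"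
    and M: "M \<in> P" "1 / 2 \<le> x M"
  shows "part_poly x P \<le> x M ^ 3 * (1 - x M)\<^sup>2 - 1 / 25 * (\<Sum>A\<in>P - {M}. (x A)\<^sup>2)"
proof -
  let ?y = "x M"
  define q where "q = (\<Sum>B\<in>P. (x B)\<^sup>2)"
  define q' where "q' = (\<Sum>B\<in>P - {M}. (x B)\<^sup>2)"
  have qq: "q = ?y\<^sup>2 + q'" unfolding q_def q'_def by (rule sum.remove[OF P M(1)])
  have term_le: "x A ^ 3 * (1 - 2 * x A + 2 * (x A)\<^sup>2 - q) \<le> 17 / 200 * (x A)\<^sup>2" if A: "A \<in> P - {M}" for A
  proof -
    define t where "t = x A"
    have "x M + x A \<le> sum x P"
      using sum_mono2[of P "{M, A}" x] P M A x by auto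
    then have t: "0 \<le> t" "t \<le> 1 / 2" using A x M sum1 by (auto simp: t_def)
    have "t\<^sup>2 \<le> q'" unfolding q'_def t_def using A P
      by (intro member_le_sum[of A "P - {M}" "\<lambda>B. (x B)\<^sup>2"]) auto
    moreover have "?y\<^sup>2 \<ge> 1 / 4" using power_mono[OF M(2), of 2] by (simp add: power2_eq_square)
    ultimately have "1 - 2 * t + 2 * t\<^sup>2 - q \<le> (1 - t)\<^sup>2 - 1 / 4"
      unfolding qq by (simp add: power2_diff)
    then have "t * (1 - 2 * t + 2 * t\<^sup>2 - q) \<le> t * ((1 - t)\<^sup>2 - 1 / 4)"
      using t(1) by (rule mult_left_mono)
    also have "\<dots> \<le> 17 / 200"
    proof -
      \<comment> \<open>The cubic \<open>t * ((1 - t)\<^sup>2 - 1 / 4)\<close> peaks near 23/100;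
        the value 154/100 is then forced by its quadratic coefficient.\<close>
      have "0 \<le> (23 / 100 - t)\<^sup>2 * (154 / 100 - t)" using t by simp
      also have "\<dots> = 17 / 200 - t * ((1 - t)\<^sup>2 - 1 / 4) - (35340 / 10000000 + 113 / 10000 * t)" by algebra
      finally show ?thesis using t by linarith
    qed
    finally have "t\<^sup>2 * (t * (1 - 2 * t + 2 * t\<^sup>2 - q)) \<le> t\<^sup>2 * (17 / 200)"
      by (rule mult_left_mono) simp
    then show ?thesis unfolding t_def[symmetric] by (simp add: power3_eq_cube power2_eq_square)
  qed
  have "part_poly x P = ?y ^ 3 * (1 - 2 * ?y + 2 * ?y\<^sup>2 - q) +
      (\<Sum>A\<in>P - {M}. x A ^ 3 * (1 - 2 * x A + 2 * (x A)\<^sup>2 - q))"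
    unfolding part_poly_eq[OF P] q_def by (rule sum.remove[OF P M(1)])
  also have "\<dots> \<le> ?y ^ 3 * (1 - 2 * ?y + 2 * ?y\<^sup>2 - q) + (\<Sum>A\<in>P - {M}. 17 / 200 * (x A)\<^sup>2)"
    by (intro add_left_mono sum_mono term_le)
  also have "\<dots> = ?y ^ 3 * (1 - ?y)\<^sup>2 - ?y ^ 3 * q' + 17 / 200 * q'"
    unfolding qq q'_def sum_distrib_left[symmetric] by algebra
  also have "\<dots> \<le> ?y ^ 3 * (1 - ?y)\<^sup>2 - 1 / 25 * q'"
  proof -
    have "?y ^ 3 \<ge> (1 / 2) ^ 3" using M(2) by (intro power_mono) auto
    then have "?y ^ 3 * q' \<ge> 1 / 8 * q'" unfolding q'_def
      by (intro mult_right_mono sum_nonneg) (auto simp: power3_eq_cube)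
    moreover have "q' \<ge> 0" unfolding q'_def by (simp add: sum_nonneg)
    ultimately show ?thesis by linarith
  qed
  finally show ?thesis unfolding q'_def .
qed

text \<open>Since 1/32 is less than 108/3125, near-optimal values rule out the case where no class
  exceeds one half, and the two estimates for a dominant class can be added.\<close>

lemma part_poly_stability:
  assumes P: "finite P" and x: "\<And>A. A \<in> P \<Longrightarrow> 0 \<le> x A" and sum1: "sum x P = 1"
    and large: "1 / 32 < part_poly x P"
  obtains M where "M \<in> P" "1 / 2 < x M"
    "part_poly x P \<le> 108 / 3125 - 12 / 125 * (x M - 3 / 5)\<^sup>2 - 1 / 25 * (\<Sum>A\<in>P - {M}. (x A)\<^sup>2)"
proof -
  obtain M where M: "M \<in> P" "1 / 2 < x M"
    using part_poly_le_if_all_parts_le_half[OF P, of x] x large by force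
  have "x M \<le> 1" using member_le_sum[OF M(1), of x] x P sum1 by auto
  then show ?thesis
    using that[OF M] part_poly_le_if_half_le[OF P x sum1 M(1)] pow3_mult_sq_le[of "x M"] M by force
qed

lemma part_poly_le:
  assumes P: "finite P" and x: "\<And>A. A \<in> P \<Longrightarrow> 0 \<le> x A" and sum1: "sum x P = 1"
  shows "part_poly x P \<le> 108 / 3125"
proof (cases "1 / 32 < part_poly x P")
  case True
  obtain M where
    "part_poly x P \<le> 108 / 3125 - 12 / 125 * (x M - 3 / 5)\<^sup>2 - 1 / 25 * (\<Sum>A\<in>P - {M}. (x A)\<^sup>2)"
    using part_poly_stability[OF P x sum1 True] .
  moreover have "0 \<le> (\<Sum>A\<in>P - {M}. (x A)\<^sup>2)" "0 \<le> (x M - 3 / 5)\<^sup>2" by (simp_all add: sum_nonneg)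
  ultimately show ?thesis by linarith
qed auto

section \<open>Counting the copies in an equivalence relation\<close>

lemma real_choose_2: "real (m choose 2) = real m * (real m - 1) / 2"
proof (induction m)
  case (Suc m)
  have "Suc m choose 2 = m + (m choose 2)" by (simp add: eval_nat_numeral)
  then show ?case using Suc.IH by (simp add: field_simps)
qed simp

lemma real_choose_3: "real (m choose 3) = real m * (real m - 1) * (real m - 2) / 6"
proof (induction m)
  case (Suc m)
  have "Suc m choose 3 = (m choose 2) + (m choose 3)" by (simp add: eval_nat_numeral)
  then show ?case using Suc.IH by (simp add: real_choose_2 field_simps)
qed simp

lemma real_choose_3_le: "real (m choose 3) \<le> real m ^ 3 / 6"
proof (cases "m \<le> 2")
  case True
  then show ?thesis by (simp add: binomial_eq_0)
next
  case False
  then have "real m * (real m - 1) * (real m - 2) \<le> real m * real m * real m"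
    by (intro mult_mono) auto
  then show ?thesis unfolding real_choose_3 by (simp add: power3_eq_cube)
qed

text \<open>A copy is a triple inside one class \<open>A\<close> together with a pair from
  \<open>Q A\<close>, the pairs outside \<open>A\<close> not contained in a class. No lower-order
  error term arises, so the bound is valid for every order and not only asymptotically.\<close>

lemma card_copies_partition_le:
  fixes P :: "'a set set"
  assumes V: "finite V" "V \<noteq> {}" and P: "partition_on V P"
    and R: "\<And>x y. x \<in> V \<Longrightarrow> y \<in> V \<Longrightarrow> R x y \<longleftrightarrow> (\<exists>A\<in>P. x \<in> A \<and> y \<in> A)"
  defines "x \<equiv> \<lambda>A. real (card A) / real (card V)"
  shows "real (card (copies R V)) \<le> real (card V) ^ 5 / 12 * part_poly x P"
    and "finite P" and "sum x P = 1"
proof -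
  define n where "n = card V"
  have n0: "n > 0" using V by (auto simp: n_def card_gt_0_iff)
  have finP: "finite P" using V(1) P by (rule finite_elements)
  have UP: "\<Union>P = V" and disj: "\<And>A B. A \<in> P \<Longrightarrow> B \<in> P \<Longrightarrow> A \<noteq> B \<Longrightarrow> A \<inter> B = {}"
    using P by (auto simp: partition_on_def disjoint_def)
  have finA: "finite A" if "A \<in> P" for A using that UP V by (auto intro: finite_subset)
  have sumn: "(\<Sum>A\<in>P. card A) = n"
    using card_Union_disjoint[of P] disj finA UP by (auto simp: n_def pairwise_def disjnt_def)
  show "finite P" by fact
  show "sum x P = 1"
    unfolding x_def sum_divide_distrib[symmetric] of_nat_sum[symmetric] sumn n_def[symmetric] using n0 by simp
  define Q where "Q A = {U. U \<subseteq> V - A \<and> card U = 2 \<and> (\<forall>B\<in>P. \<not> U \<subseteq> B)}" for A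
  have finQ: "finite (Q A)" for A
    by (rule finite_subset[of _ "Pow V"]) (use V in \<open>auto simp: Q_def\<close>)
  have cQ: "real (card (Q A)) = ((real n - card A)\<^sup>2 - (\<Sum>B\<in>P - {A}. (real (card B))\<^sup>2)) / 2"
    if A: "A \<in> P" for A
  proof -
    have VA: "real (card (V - A)) = real n - card A"
      using A UP V by (subst card_Diff_subset) (auto simp: n_def of_nat_diff card_mono finA Union_upper)
    define W where "W = (\<Union>B\<in>P - {A}. {U. U \<subseteq> B \<and> card U = 2})"
    have finW: "finite W" unfolding W_def using finP finA by (auto intro!: finite_Collect_conjI disjI1)
    have cW: "card W = (\<Sum>B\<in>P - {A}. card B choose 2)"
      unfolding W_def
    proof (subst card_UN_disjoint)
      show "\<forall>B\<in>P - {A}. \<forall>C\<in>P - {A}. B \<noteq> C \<longrightarrow>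
        {U. U \<subseteq> B \<and> card U = 2} \<inter> {U. U \<subseteq> C \<and> card U = 2} = {}"
      proof (intro ballI impI equals0I)
        fix B C U assume "B \<in> P - {A}" "C \<in> P - {A}" "B \<noteq> C"
          and "U \<in> {U. U \<subseteq> B \<and> card U = 2} \<inter> {U. U \<subseteq> C \<and> card U = 2}"
        then have "U \<subseteq> {}" "card U = 2" using disj[of B C] by auto
        then show False by simp
      qed
    qed (use finP finA in \<open>auto simp: n_subsets intro!: finite_Collect_conjI disjI1\<close>)
    have WA: "W \<subseteq> {U. U \<subseteq> V - A \<and> card U = 2}"
      unfolding W_def using UP disj A by blast
    have "Q A = {U. U \<subseteq> V - A \<and> card U = 2} - W"
    proof
      show "Q A \<subseteq> {U. U \<subseteq> V - A \<and> card U = 2} - W" by (auto simp: Q_def W_def)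
      show "{U. U \<subseteq> V - A \<and> card U = 2} - W \<subseteq> Q A"
      proof
        fix U assume U: "U \<in> {U. U \<subseteq> V - A \<and> card U = 2} - W"
        moreover have "\<not> U \<subseteq> A"
        proof
          assume "U \<subseteq> A"
          then have "U = {}" using U by auto
          then show False using U by simp
        qed
        ultimately show "U \<in> Q A" unfolding Q_def W_def by auto
      qed
    qed
    then have "card (Q A) = card {U. U \<subseteq> V - A \<and> card U = 2} - card W"
      using finW WA by (simp add: card_Diff_subset)
    moreover have "card W \<le> card {U. U \<subseteq> V - A \<and> card U = 2}"
      using WA V by (intro card_mono) auto
    moreover have "card {U. U \<subseteq> V - A \<and> card U = 2} = (card (V - A) choose 2)"
      using V by (simp add: n_subsets)
    ultimately have "real (card (Q A)) = real (card (V - A) choose 2) - (\<Sum>B\<in>P - {A}. real (card B choose 2))"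
      by (simp add: cW of_nat_diff)
    also have "real (card (V - A) choose 2) = ((real n - card A)\<^sup>2 - (real n - card A)) / 2"
      unfolding real_choose_2 VA by (simp add: power2_eq_square algebra_simps)
    also have "(\<Sum>B\<in>P - {A}. real (card B choose 2)) =
        ((\<Sum>B\<in>P - {A}. (real (card B))\<^sup>2) - (\<Sum>B\<in>P - {A}. real (card B))) / 2"
      by (simp add: real_choose_2 sum_subtractf[symmetric] sum_divide_distrib[symmetric] power2_eq_square algebra_simps)
    \<comment> \<open>The other classes fill \<open>V - A\<close>, so the linear terms of the
      binomial coefficients cancel and the formula for \<open>card (Q A)\<close> is purely
      quadratic.\<close>
    also have "(\<Sum>B\<in>P - {A}. real (card B)) = real n - card A"
      using sum.remove[OF finP A, of card] sumn by (simp flip: of_nat_sum)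
    finally show ?thesis by (simp add: field_simps)
  qed
  have "copies R V \<subseteq> (\<Union>A\<in>P. {T. T \<subseteq> A \<and> card T = 3} \<times> Q A)"
  proof (rule subrelI)
    fix T U assume TU: "(T, U) \<in> copies R V"
    note D = copiesD[OF TU]
    have "T \<noteq> {}" using D(3) by auto
    then obtain t where t: "t \<in> T" by blast
    then obtain A where A: "A \<in> P" "t \<in> A" using D(1) UP by blast
    have "y \<in> A" if y: "y \<in> T" for y
    proof -
      obtain B where "B \<in> P" "t \<in> B" "y \<in> B" using D(8)[OF t y] R D(1) t y by blast
      then show ?thesis using disj[of A B] A by blast
    qed
    moreover have "y \<notin> A" if y: "y \<in> U" for y
      using D(9)[OF y, of t] R[of y t] D(1,2,5) t y A by blast
    moreover have "\<not> U \<subseteq> B" if "B \<in> P" for B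
    proof
      assume UB: "U \<subseteq> B"
      obtain u w where "U = {u, w}" "u \<noteq> w" using D(4) by (auto simp: card_2_iff)
      then show False using D(9)[of u w] R[of u w] D(2) UB that by blast
    qed
    ultimately show "(T, U) \<in> (\<Union>A\<in>P. {T. T \<subseteq> A \<and> card T = 3} \<times> Q A)"
      using A D(2,3,4) unfolding Q_def by blast
  qed
  then have "card (copies R V) \<le> card (\<Union>A\<in>P. {T. T \<subseteq> A \<and> card T = 3} \<times> Q A)"
    using finP finQ finA by (intro card_mono) auto
  also have "\<dots> \<le> (\<Sum>A\<in>P. card ({T. T \<subseteq> A \<and> card T = 3} \<times> Q A))"
    by (rule card_UN_le[OF finP])
  also have "\<dots> = (\<Sum>A\<in>P. (card A choose 3) * card (Q A))"
    using finA by (intro sum.cong refl) (simp add: card_cartesian_product n_subsets)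
  finally have "real (card (copies R V)) \<le> (\<Sum>A\<in>P. real (card A choose 3) * real (card (Q A)))"
    by (metis (mono_tags, lifting) of_nat_le_iff of_nat_mult of_nat_sum sum.cong)
  also have "\<dots> \<le> (\<Sum>A\<in>P. real (card A) ^ 3 / 6 * real (card (Q A)))"
    by (intro sum_mono mult_right_mono real_choose_3_le) auto
  also have "\<dots> = (\<Sum>A\<in>P. real n ^ 5 / 12 * (x A ^ 3 * ((1 - x A)\<^sup>2 - (\<Sum>B\<in>P - {A}. (x B)\<^sup>2))))"
  proof (rule sum.cong[OF refl])
    fix A assume A: "A \<in> P"
    have c: "real (card B) = real n * x B" for B using n0 by (simp add: x_def n_def)
    define s where "s = (\<Sum>B\<in>P - {A}. (x B)\<^sup>2)"
    have s: "(\<Sum>B\<in>P - {A}. (real n * x B)\<^sup>2) = (real n)\<^sup>2 * s"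
      by (simp add: s_def power_mult_distrib sum_distrib_left)
    show "real (card A) ^ 3 / 6 * real (card (Q A)) =
        real n ^ 5 / 12 * (x A ^ 3 * ((1 - x A)\<^sup>2 - (\<Sum>B\<in>P - {A}. (x B)\<^sup>2)))"
      unfolding cQ[OF A] c s s_def[symmetric]
      by (simp add: power2_eq_square power3_eq_cube eval_nat_numeral field_simps)
  qed
  also have "\<dots> = real n ^ 5 / 12 * part_poly x P"
    unfolding part_poly_def sum_distrib_left ..
  finally show "real (card (copies R V)) \<le> real (card V) ^ 5 / 12 * part_poly x P"
    by (simp add: n_def)
qed

lemma partition_of_equivalence:
  assumes "\<And>x y. R x y \<longleftrightarrow> R y x" "\<And>x. R x x"
    and "\<forall>x\<in>V. \<forall>y\<in>V. \<forall>z\<in>V. R x y \<longrightarrow> R y z \<longrightarrow> R x z"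
  obtains P where "partition_on V P"
    "\<And>x y. x \<in> V \<Longrightarrow> y \<in> V \<Longrightarrow> R x y \<longleftrightarrow> (\<exists>A\<in>P. x \<in> A \<and> y \<in> A)"
proof -
  define r where "r = {(x, y). x \<in> V \<and> y \<in> V \<and> R x y}"
  have eq: "equiv V r"
    using assms unfolding r_def equiv_def refl_on_def sym_def trans_def by blast
  have "R x y \<longleftrightarrow> (\<exists>A\<in>V // r. x \<in> A \<and> y \<in> A)" if xy: "x \<in> V" "y \<in> V" for x y
  proof
    assume "R x y"
    then have "x \<in> r `` {x}" "y \<in> r `` {x}" using xy assms(2) by (auto simp: r_def)
    then show "\<exists>A\<in>V // r. x \<in> A \<and> y \<in> A" using xy by (meson quotientI)
  next
    assume "\<exists>A\<in>V // r. x \<in> A \<and> y \<in> A"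
    then have "(x, y) \<in> r" using quotient_eq_iff[OF eq] by blast
    then show "R x y" by (simp add: r_def)
  qed
  then show ?thesis using that[of "V // r"] partition_on_quotient[OF eq] by blast
qed

text \<open>Only the count has to be followed along the symmetrisation: the bound for equivalence
  relations, with 9/3125 = (108/3125) / 12, passes back to \<open>R\<close>.\<close>

lemma card_copies_le:
  fixes V :: "'a set"
  assumes V: "finite V" and sym: "\<And>x y. R x y \<longleftrightarrow> R y x" and refl: "\<And>x. R x x"
  shows "real (card (copies R V)) \<le> 9 / 3125 * real (card V) ^ 5"
proof (cases "V = {}")
  case True
  then have "copies R V = {}" by (auto simp: copies_def)
  then show ?thesis by simp
next
  case False
  show ?thesis
    using V sym refl
  proof (induction rule: symmetrisation_induct)
    case (equivalence R)
    obtain P where P: "partition_on V P"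
      "\<And>x y. x \<in> V \<Longrightarrow> y \<in> V \<Longrightarrow> R x y \<longleftrightarrow> (\<exists>A\<in>P. x \<in> A \<and> y \<in> A)"
      by (rule partition_of_equivalence[OF equivalence]) blast
    define x :: "'a set \<Rightarrow> real" where "x A = real (card A) / real (card V)" for A
    note le = card_copies_partition_le[OF V False P, folded x_def]
    have "part_poly x P \<le> 108 / 3125"
      by (rule part_poly_le[OF le(2) _ le(3)]) (auto simp: x_def)
    then have "real (card V) ^ 5 / 12 * part_poly x P \<le> real (card V) ^ 5 / 12 * (108 / 3125)"
      by (intro mult_left_mono) auto
    then show ?case using le(1) by simp
  next
    case (clone R u v)
    then show ?case by linarith
  qed
qed

subsection \<open>Correcting a vertex\<close>

text \<open>The reflexive complement of the extremal graph, in which \<open>X\<close> is independent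
  and all other vertices are universal.\<close>

definition clique_rel :: "'a set \<Rightarrow> 'a \<Rightarrow> 'a \<Rightarrow> bool" where
  "clique_rel X x y \<longleftrightarrow> x = y \<or> x \<in> X \<and> y \<in> X"

text \<open>Ordered pairs are used, so that the cardinality is the sum of the numbers of wrong pairs
  at the single vertices.\<close>

definition bad :: "('a \<Rightarrow> 'a \<Rightarrow> bool) \<Rightarrow> 'a set \<Rightarrow> 'a set \<Rightarrow> ('a \<times> 'a) set" where
  "bad R X V = {(x, y). x \<in> V \<and> y \<in> V \<and> R x y \<noteq> clique_rel X x y}"

definition badn :: "('a \<Rightarrow> 'a \<Rightarrow> bool) \<Rightarrow> 'a set \<Rightarrow> 'a set \<Rightarrow> 'a \<Rightarrow> 'a set" where
  "badn R X V v = {w \<in> V. R v w \<noteq> clique_rel X v w}"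

definition patch :: "'a \<Rightarrow> ('a \<Rightarrow> 'a \<Rightarrow> bool) \<Rightarrow> ('a \<Rightarrow> 'a \<Rightarrow> bool) \<Rightarrow> 'a \<Rightarrow> 'a \<Rightarrow> bool" where
  "patch v R R' x y = (if x = v \<or> y = v then R x y else R' x y)"

lemma finite_bad: "finite V \<Longrightarrow> finite (bad R X V)"
  by (rule finite_subset[of _ "V \<times> V"]) (auto simp: bad_def)

lemma finite_badn: "finite V \<Longrightarrow> finite (badn R X V v)"
  by (simp add: badn_def)

lemma bad_eq_Sigma: "bad R X V = Sigma V (badn R X V)"
  by (auto simp: bad_def badn_def)

lemma card_bad_eq_sum: "finite V \<Longrightarrow> card (bad R X V) = (\<Sum>v\<in>V. card (badn R X V v))"
  by (simp add: bad_eq_Sigma card_SigmaI finite_badn)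

lemma clique_rel_sym: "clique_rel X x y \<longleftrightarrow> clique_rel X y x"
  by (auto simp: clique_rel_def)

lemma clique_rel_refl: "clique_rel X x x"
  by (simp add: clique_rel_def)

text \<open>On a set that is not counted by the error term, either \<open>R\<close> and \<open>C\<close> agree at \<open>v\<close> or they
  agree away from \<open>v\<close>; in both cases the two patches are \<open>R\<close> and \<open>C\<close> again, in some order.\<close>

lemma card_copies_patch:
  assumes V: "finite V" and sym: "\<And>x y. R x y \<longleftrightarrow> R y x" "\<And>x y. C x y \<longleftrightarrow> C y x"
  shows "card (copies R V) + card (copies C V) \<le>
    card (copies (patch v C R) V) + card (copies (patch v R C) V) +
    2 * card {S. S \<subseteq> V \<and> card S = 5 \<and> v \<in> S \<and> (\<exists>w\<in>S. R v w \<noteq> C v w) \<and>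
      (\<exists>x\<in>S - {v}. \<exists>y\<in>S - {v}. R x y \<noteq> C x y)}"
    (is "_ \<le> _ + _ + 2 * card ?D")
proof -
  define G1 where "G1 = {(T, U). T \<union> U \<subseteq> V \<and> \<not> (v \<in> T \<union> U \<and> (\<exists>w\<in>T \<union> U. R v w \<noteq> C v w))}"
  define G2 where "G2 = {(T, U). T \<union> U \<subseteq> V \<and> \<not> (\<exists>x\<in>T \<union> U - {v}. \<exists>y\<in>T \<union> U - {v}. R x y \<noteq> C x y)} - G1"
  let ?R' = "patch v C R" and ?C' = "patch v R C"
  have fD: "finite ?D" by (rule finite_subset[of _ "Pow V"]) (use V in auto)
  have symD: "R x v = C x v" if "R v x = C v x" for x using that sym by blast
  have e1: "copies R V \<inter> G1 = copies ?R' V \<inter> G1" "copies C V \<inter> G1 = copies ?C' V \<inter> G1"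
  proof -
    have *: "R x y = ?R' x y \<and> C x y = ?C' x y"
      if "(T, U) \<in> G1" "x \<in> T \<union> U" "y \<in> T \<union> U" for T U x y
    proof -
      have "x = v \<Longrightarrow> R v y = C v y" "y = v \<Longrightarrow> R v x = C v x"
        using that by (auto simp: G1_def)
      then show ?thesis using symD[of x] by (auto simp: patch_def)
    qed
    have "(T, U) \<in> copies R V \<longleftrightarrow> (T, U) \<in> copies ?R' V"
      and "(T, U) \<in> copies C V \<longleftrightarrow> (T, U) \<in> copies ?C' V" if "(T, U) \<in> G1" for T U
      using *[OF that] by (auto intro!: copies_cong)
    then show "copies R V \<inter> G1 = copies ?R' V \<inter> G1" "copies C V \<inter> G1 = copies ?C' V \<inter> G1" by auto
  qed
  have e2: "copies R V \<inter> G2 = copies ?C' V \<inter> G2" "copies C V \<inter> G2 = copies ?R' V \<inter> G2"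
  proof -
    have *: "R x y = ?C' x y \<and> C x y = ?R' x y"
      if "(T, U) \<in> G2" "x \<in> T \<union> U" "y \<in> T \<union> U" for T U x y
      using that by (auto simp: G2_def patch_def)
    have "(T, U) \<in> copies R V \<longleftrightarrow> (T, U) \<in> copies ?C' V"
      and "(T, U) \<in> copies C V \<longleftrightarrow> (T, U) \<in> copies ?R' V" if "(T, U) \<in> G2" for T U
      using *[OF that] by (auto intro!: copies_cong)
    then show "copies R V \<inter> G2 = copies ?C' V \<inter> G2" "copies C V \<inter> G2 = copies ?R' V \<inter> G2" by auto
  qed
  \<comment> \<open>The copies outside \<open>G1 \<union> G2\<close> are bounded once for
    \<open>R\<close> and once for \<open>C\<close>; hence the factor 2 in the error term.\<close>
  have rest: "card (copies Q V - (G1 \<union> G2)) \<le> card ?D" for Q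
  proof (rule card_copies_outside_le[OF V _ fD])
    fix T U assume TU: "(T, U) \<in> copies Q V" "(T, U) \<notin> G1 \<union> G2"
    have "T \<union> U \<subseteq> V" using copiesD(1,2)[OF TU(1)] by simp
    then show "T \<union> U \<in> ?D" using TU(2) card_Un_copies[OF TU(1)]
      unfolding G1_def G2_def by blast
  qed
  have dis: "G1 \<inter> G2 = {}" by (auto simp: G2_def)
  have two: "card (copies Q V \<inter> (G1 \<union> G2)) = card (copies Q V \<inter> G1) + card (copies Q V \<inter> G2)" for Q
    unfolding Int_Un_distrib using finite_copies[OF V] dis by (intro card_Un_disjoint) auto
  have split: "card (copies Q V) = card (copies Q V \<inter> (G1 \<union> G2)) + card (copies Q V - (G1 \<union> G2))" for Q
    using finite_copies[OF V, of Q] by (metis Diff_disjoint Int_Diff_Un card_Un_disjoint finite_Diff finite_Int Int_Diff_disjoint)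
  show ?thesis
    using split[of R] split[of C] split[of ?R'] split[of ?C'] rest[of R] rest[of C]
      two[of R] two[of C] two[of ?R'] two[of ?C'] e1[THEN arg_cong[of _ _ card]]
      e2[THEN arg_cong[of _ _ card]] by linarith
qed

text \<open>Either the wrong pair at \<open>v\<close> and the other wrong pair are disjoint, leaving
  one free vertex, or they share the vertex \<open>w\<close>, leaving two. The second count stays a
  sum over \<open>w\<close>, because two different bounds for it are needed in
  \<open>gain_vertex\<close>.\<close>

lemma card_double_bad_le:
  assumes V: "finite V" and sym: "\<And>x y. R x y \<longleftrightarrow> R y x" and refl: "\<And>x. R x x"
  shows "card {S. S \<subseteq> V \<and> card S = 5 \<and> v \<in> S \<and> (\<exists>w\<in>S. R v w \<noteq> clique_rel X v w) \<and>
      (\<exists>x\<in>S - {v}. \<exists>y\<in>S - {v}. R x y \<noteq> clique_rel X x y)}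
    \<le> card (badn R X V v) * card (bad R X V) * card V +
      (\<Sum>w\<in>badn R X V v. card (badn R X V w)) * card V ^ 2"
    (is "card ?S \<le> _")
proof -
  let ?W = "badn R X V v"
  let ?A = "?W \<times> bad R X V \<times> V" and ?B = "Sigma ?W (badn R X V) \<times> V \<times> V"
  let ?f = "\<lambda>(w, (x, y), z). {v, w, x, y, z}" and ?g = "\<lambda>((w, y), z, z'). {v, w, y, z, z'}"
  have fA: "finite ?A" and fB: "finite ?B"
    using V by (auto intro!: finite_badn finite_bad)
  have "?S \<subseteq> ?f ` ?A \<union> ?g ` ?B"
  proof
    fix S assume "S \<in> ?S"
    then obtain w x y where S: "S \<subseteq> V" "card S = 5" "v \<in> S"
      and w: "w \<in> S" "R v w \<noteq> clique_rel X v w"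
      and xy: "x \<in> S" "y \<in> S" "x \<noteq> v" "y \<noteq> v" "R x y \<noteq> clique_rel X x y" by blast
    have ne: "w \<noteq> v" "x \<noteq> y" using w xy refl by (auto simp: clique_rel_def)
    have wW: "w \<in> ?W" using w S by (auto simp: badn_def)
    show "S \<in> ?f ` ?A \<union> ?g ` ?B"
    proof (cases "w = x \<or> w = y")
      case False
      then have "card (S - {v, w, x, y}) = 1"
        using S w xy ne by (subst card_Diff_subset) auto
      then obtain z where "S - {v, w, x, y} = {z}" by (auto simp: card_1_singleton_iff)
      then have "S = ?f (w, (x, y), z)" "z \<in> V" using S w xy by auto
      moreover have "(x, y) \<in> bad R X V" using xy S by (auto simp: bad_def)
      ultimately show ?thesis using wW by blast
    next
      case True
      then obtain y' where y': "y' \<in> S" "y' \<noteq> v" "y' \<noteq> w" "R w y' \<noteq> clique_rel X w y'"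
        using xy sym clique_rel_sym ne by metis
      then have "card (S - {v, w, y'}) = 2"
        using S w ne by (subst card_Diff_subset) auto
      then obtain z z' where "S - {v, w, y'} = {z, z'}" by (auto simp: card_2_iff)
      then have "S = ?g ((w, y'), z, z')" "z \<in> V" "z' \<in> V" using S w y' by auto
      moreover have "y' \<in> badn R X V w" using y' S by (auto simp: badn_def)
      ultimately show ?thesis using wW by blast
    qed
  qed
  then have "card ?S \<le> card (?f ` ?A \<union> ?g ` ?B)" using fA fB by (intro card_mono) auto
  also have "\<dots> \<le> card ?A + card ?B"
    using card_Un_le[of "?f ` ?A" "?g ` ?B"] card_image_le[OF fA, of ?f] card_image_le[OF fB, of ?g] by linarith
  also have "card ?A = card ?W * card (bad R X V) * card V" by (simp add: card_cartesian_product)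
  also have "card ?B = (\<Sum>w\<in>?W. card (badn R X V w)) * card V ^ 2"
    using V by (simp add: card_cartesian_product card_SigmaI finite_badn power2_eq_square mult_ac)
  finally show ?thesis .
qed

section \<open>Copies in the model, and in the model rewired at one vertex\<close>

lemma copies_clique_rel:
  assumes "X \<subseteq> V"
  shows "copies (clique_rel X) V = {T. T \<subseteq> X \<and> card T = 3} \<times> {U. U \<subseteq> V - X \<and> card U = 2}"
proof (intro equalityI subrelI)
  fix T U assume TU: "(T, U) \<in> copies (clique_rel X) V"
  note D = copiesD[OF TU]
  have TX: "T \<subseteq> X"
  proof
    fix x assume x: "x \<in> T"
    have "T \<noteq> {x}" using D(3) by auto
    then obtain y where "y \<in> T" "y \<noteq> x" using x by blast
    then show "x \<in> X" using D(8)[OF x] by (auto simp: clique_rel_def)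
  qed
  have "T \<noteq> {}" using D(3) by auto
  then obtain t where t: "t \<in> T" by blast
  have "u \<notin> X" if "u \<in> U" for u
    using D(9)[OF that, of t] D(5) t TX that by (auto simp: clique_rel_def)
  then show "(T, U) \<in> {T. T \<subseteq> X \<and> card T = 3} \<times> {U. U \<subseteq> V - X \<and> card U = 2}"
    using TX D(2,3,4) by auto
next
  fix T U assume "(T, U) \<in> {T. T \<subseteq> X \<and> card T = 3} \<times> {U. U \<subseteq> V - X \<and> card U = 2}"
  then show "(T, U) \<in> copies (clique_rel X) V"
    using assms unfolding copies_def by (auto simp: clique_rel_def)
qed

lemma card_copies_clique_rel:
  assumes "finite V" "X \<subseteq> V"
  shows "card (copies (clique_rel X) V) = (card X choose 3) * (card (V - X) choose 2)"
  unfolding copies_clique_rel[OF assms(2)]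
  using assms by (simp add: card_cartesian_product n_subsets finite_subset)

text \<open>The summands sort the copies by the place of \<open>v\<close>: outside the copy, in
  \<open>T\<close>, or in \<open>U\<close>. Away from \<open>v\<close> the relation is the model,
  and a triple without \<open>v\<close> still has two vertices, enough to force
  \<open>T - {v}\<close> into \<open>X'\<close> and then \<open>U - {v}\<close> into
  \<open>Y'\<close>.\<close>

lemma card_copies_patch_clique_rel_le:
  fixes v :: 'a
  assumes V: "finite V" "X \<subseteq> V" and sym: "\<And>x y. R x y \<longleftrightarrow> R y x"
  defines "X' \<equiv> X - {v}" and "Y' \<equiv> V - X - {v}"
  shows "card (copies (patch v R (clique_rel X)) V) \<le>
    (card X' choose 3) * (card Y' choose 2) +
    ((card {w \<in> X'. R v w} choose 2) * (card {w \<in> Y'. \<not> R v w} choose 2) +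
     (card {w \<in> X'. \<not> R v w} choose 3) * card {w \<in> Y'. \<not> R v w})"
proof -
  let ?R = "patch v R (clique_rel X)"
  define NX where "NX = {w \<in> X'. R v w}"
  define MX where "MX = {w \<in> X'. \<not> R v w}"
  define MY where "MY = {w \<in> Y'. \<not> R v w}"
  have fin: "finite X'" "finite Y'" "finite NX" "finite MX" "finite MY"
    using V by (auto simp: X'_def Y'_def NX_def MX_def MY_def intro: finite_subset)
  define A where "A = {T. T \<subseteq> X' \<and> card T = 3} \<times> {U. U \<subseteq> Y' \<and> card U = 2}"
  define B where "B = {T. T \<subseteq> NX \<and> card T = 2} \<times> {U. U \<subseteq> MY \<and> card U = 2}"
  define C where "C = {T. T \<subseteq> MX \<and> card T = 3} \<times> MY"
  have fABC: "finite A" "finite B" "finite C" using fin by (auto simp: A_def B_def C_def)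
  have "copies ?R V \<subseteq> A \<union> ((\<lambda>(T, U). (insert v T, U)) ` B \<union> (\<lambda>(T, z). (T, {v, z})) ` C)"
  proof (rule subrelI)
    fix T U assume TU: "(T, U) \<in> copies ?R V"
    note D = copiesD[OF TU]
    have R: "?R x y = clique_rel X x y" if "x \<noteq> v" "y \<noteq> v" for x y using that by (simp add: patch_def)
    have Rv: "?R v y = R v y" "?R y v = R v y" for y using sym by (auto simp: patch_def)
    have TX: "x \<in> X'" if x: "x \<in> T" "x \<noteq> v" for x
    proof -
      have "card (T - {x, v}) > 0"
        using D(3,6) x by (subst card_Diff_subset_Int) (auto simp: card_insert_if Int_insert_right)
      then obtain y where "y \<in> T" "y \<noteq> x" "y \<noteq> v" by (metis card_gt_0_iff DiffD1 DiffD2 insertCI ex_in_conv)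
      then show ?thesis using D(8)[OF x(1), of y] R x by (auto simp: clique_rel_def X'_def)
    qed
    have UY: "u \<in> Y'" if u: "u \<in> U" "u \<noteq> v" for u
    proof -
      have "T \<noteq> {v}" "T \<noteq> {}" using D(3) by auto
      then obtain t where t: "t \<in> T" "t \<noteq> v" by blast
      then show ?thesis using D(9)[OF u(1), of t] D(2,5) TX[OF t] R u by (auto simp: clique_rel_def Y'_def X'_def)
    qed
    consider "v \<in> T" | "v \<in> U" | "v \<notin> T \<union> U" by blast
    then show "(T, U) \<in> A \<union> ((\<lambda>(T, U). (insert v T, U)) ` B \<union> (\<lambda>(T, z). (T, {v, z})) ` C)"
    proof cases
      case 1
      then have vU: "v \<notin> U" using D(5) by auto
      have "T - {v} \<subseteq> NX" using TX D(8)[OF 1] Rv by (auto simp: NX_def)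
      moreover have "U \<subseteq> MY"
      proof
        fix u assume "u \<in> U"
        then show "u \<in> MY" using UY[of u] D(9)[of u v] 1 vU Rv by (auto simp: MY_def)
      qed
      moreover have "card (T - {v}) = 2" using 1 D(3) by simp
      ultimately have "(T - {v}, U) \<in> B" using D(4) by (auto simp: B_def)
      then show ?thesis using 1 by (intro UnI2 UnI1 image_eqI[of _ _ "(T - {v}, U)"]) auto
    next
      case 2
      then have vT: "v \<notin> T" using D(5) by auto
      have "card (U - {v}) = 1" using 2 D(4) by simp
      then obtain z where z: "U - {v} = {z}" by (auto simp: card_1_singleton_iff)
      then have U: "U = {v, z}" and zU: "z \<in> U" "z \<noteq> v" using 2 by auto
      have "z \<in> MY" using UY[OF zU] D(9)[OF 2, of z] zU Rv by (auto simp: MY_def)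
      moreover have "T \<subseteq> MX"
      proof
        fix t assume "t \<in> T"
        then show "t \<in> MX" using TX[of t] D(9)[OF 2, of t] vT Rv by (auto simp: MX_def)
      qed
      ultimately have "(T, z) \<in> C" using D(3) by (auto simp: C_def)
      then show ?thesis using U by (intro UnI2 image_eqI[of _ _ "(T, z)"]) auto
    next
      case 3
      then have "T \<subseteq> X'" "U \<subseteq> Y'" using TX UY by blast+
      then show ?thesis using D(3,4) by (auto simp: A_def)
    qed
  qed
  then have "card (copies ?R V) \<le> card (A \<union> ((\<lambda>(T, U). (insert v T, U)) ` B \<union> (\<lambda>(T, z). (T, {v, z})) ` C))"
    using fABC by (intro card_mono) auto
  also have "\<dots> \<le> card A + (card B + card C)"
    using fABC by (meson card_Un_le card_image_le add_mono le_trans order_refl)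
  also have "card A = (card X' choose 3) * (card Y' choose 2)"
    unfolding A_def using fin by (simp add: card_cartesian_product n_subsets)
  also have "card B = (card NX choose 2) * (card MY choose 2)"
    unfolding B_def using fin by (simp add: card_cartesian_product n_subsets)
  also have "card C = (card MX choose 3) * card MY"
    unfolding C_def using fin by (simp add: card_cartesian_product n_subsets)
  finally show ?thesis by (simp add: NX_def MX_def MY_def)
qed

text \<open>Pulling a factor \<open>k\<close> out of both terms makes the copies through a rewired
  vertex comparable with those in the model, which have a factor \<open>b\<close>.\<close>

lemma choose_bound_aux:
  fixes k b p l :: nat
  assumes "k \<le> b"
  shows "real (l choose 2) * real (k choose 2) + real (p choose 3) * real k
    \<le> real k * (real (l choose 2) * ((real b - 1) / 2) + real (p choose 3))"
proof -
  have "real k * (real k - 1) \<le> real k * (real b - 1)" using assms by (intro mult_left_mono) auto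
  then have "real (k choose 2) \<le> real k * ((real b - 1) / 2)" by (simp add: real_choose_2)
  then have "real (l choose 2) * real (k choose 2) \<le> real (l choose 2) * (real k * ((real b - 1) / 2))"
    by (rule mult_left_mono) simp
  then show ?thesis by (simp add: algebra_simps)
qed

text \<open>The gains compare the copies through a vertex \<open>v\<close> of the model (a clique and isolated
  vertices) with the copies through \<open>v\<close> after rewiring \<open>v\<close> to \<open>l\<close> of the \<open>a\<close> other clique
  vertices and to \<open>b - k\<close> of the \<open>b\<close> other isolated ones.\<close>

lemma gain_clique_vertex:
  fixes n a b k l p :: nat
  assumes n: "n \<ge> 200" "a + b + 1 = n" "(11 / 20) * real n \<le> real a + 1" "real a + 1 \<le> (13 / 20) * real n"
    and k: "k \<le> b" and lp: "l + p = a" and p: "2 * real p \<le> real a + 1"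
  shows "real (a choose 2) * real (b choose 2) - real (l choose 2) * real (k choose 2)
      - real (p choose 3) * real k \<ge> real n ^ 3 * (real p + (real b - real k)) / 500"
proof -
  define N where "N = real n"
  \<comment> \<open>The gain is at least \<open>b * (Q0 - Q1) + (b - k) * Q1\<close>. The first
    summand pays for the \<open>p\<close> wrong pairs towards the clique, at the rate (3/10) (1/150)
    = 1/500, and the second for the \<open>b - k\<close> wrong pairs towards isolated
    vertices.\<close>
  define Q0 where "Q0 = real (a choose 2) * ((real b - 1) / 2)"
  define Q1 where "Q1 = real (l choose 2) * ((real b - 1) / 2) + real (p choose 3)"
  have N: "N \<ge> 200" "real a + real b + 1 = N" "(11 / 20) * N \<le> real a + 1" "real a + 1 \<le> (13 / 20) * N"
    using n by (auto simp: N_def)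
  have N3: "0 \<le> N * N * N" using N by simp
  have l: "real l = real a - real p" using lp by simp
  have l11: "real l \<ge> (27 / 100) * N" using N p l by linarith
  have l12: "real l - 1 \<ge> (13 / 50) * N" using N p l by linarith
  have b11: "(real b - 1) / 2 \<ge> (17 / 100) * N" using N by (simp add: field_simps)
  have b12: "real b \<ge> (3 / 10) * N" using N by (simp add: field_simps)
  have "real l * (real l - 1) \<ge> ((27 / 100) * N) * ((13 / 50) * N)" using l11 l12 N by (intro mult_mono) auto
  then have l2: "real (l choose 2) \<ge> (3 / 100) * (N * N)"
    using zero_le_square[of N] unfolding real_choose_2 by linarith
  have Q1: "Q1 \<ge> N ^ 3 / 500"
  proof -
    have "real (l choose 2) * ((real b - 1) / 2) \<ge> ((3 / 100) * (N * N)) * ((17 / 100) * N)"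
      using b11 N l2 by (intro mult_mono) auto
    moreover have "0 \<le> real (p choose 3)" by simp
    ultimately show ?thesis using N3 unfolding Q1_def power3_eq_cube by linarith
  qed
  have Q01: "Q0 - Q1 \<ge> N\<^sup>2 * real p / 150"
  proof -
    have "real (a choose 2) - real (l choose 2) = real p * ((real a + real l - 1) / 2)"
      unfolding real_choose_2 l by (simp add: field_simps)
    moreover have "real p * ((real a + real l - 1) / 2) \<ge> real p * ((2 / 5) * N)"
      using N l12 by (intro mult_left_mono) auto
    ultimately have E: "real (a choose 2) - real (l choose 2) \<ge> real p * ((2 / 5) * N)" by simp
    moreover have "0 \<le> real p * ((2 / 5) * N)" using N by simp
    ultimately have "0 \<le> real (a choose 2) - real (l choose 2)" by linarith
    then have "(real (a choose 2) - real (l choose 2)) * ((real b - 1) / 2) \<ge> (real p * ((2 / 5) * N)) * ((17 / 100) * N)"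
      using E b11 N by (intro mult_mono) auto
    moreover have "real (p choose 3) \<le> real p * (((33 / 100) * N) * ((33 / 100) * N)) / 6"
    proof -
      have "real p \<le> (33 / 100) * N" using N p by linarith
      then have "real p * real p \<le> ((33 / 100) * N) * ((33 / 100) * N)" by (intro mult_mono) auto
      then have "real p * (real p * real p) \<le> real p * (((33 / 100) * N) * ((33 / 100) * N))" by (intro mult_left_mono) auto
      moreover have "real p ^ 3 = real p * (real p * real p)" by (simp add: power3_eq_cube)
      ultimately show ?thesis using real_choose_3_le[of p] by linarith
    qed
    moreover have "0 \<le> real p * (N * N)" by simp
    ultimately show ?thesis unfolding Q0_def Q1_def by (simp add: algebra_simps power2_eq_square)
  qed
  have F1: "real b * (Q0 - Q1) \<ge> ((3 / 10) * N) * (N\<^sup>2 * real p / 150)"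
    using Q01 b12 N by (intro mult_mono) auto
  have "(real b - real k) * Q1 \<ge> (real b - real k) * (N ^ 3 / 500)"
    using Q1 k by (intro mult_left_mono) auto
  moreover have "real (l choose 2) * real (k choose 2) + real (p choose 3) * real k \<le> real k * Q1"
    unfolding Q1_def by (rule choose_bound_aux[OF k])
  moreover have "real (a choose 2) * real (b choose 2) = real b * Q0"
    unfolding Q0_def real_choose_2[of b] by simp
  moreover have "real b * (Q0 - Q1) = real b * Q0 - real b * Q1" "(real b - real k) * Q1 = real b * Q1 - real k * Q1"
    "((3 / 10) * N) * (N\<^sup>2 * real p / 150) = N ^ 3 * real p / 500"
    "N ^ 3 * (real p + (real b - real k)) / 500 = N ^ 3 * real p / 500 + (real b - real k) * (N ^ 3 / 500)"
    by (simp_all add: algebra_simps add_divide_distrib diff_divide_distrib power3_eq_cube power2_eq_square)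
  ultimately show ?thesis unfolding N_def[symmetric] using F1 by linarith
qed

text \<open>The bound on \<open>l\<close> is the balance condition. With \<open>l = a\<close> and
  \<open>k = b\<close> the vertex would become a clique vertex, which at proportion 3/5 costs
  nothing to leading order.\<close>

lemma gain_isolated_vertex:
  fixes n a b k l p :: nat
  assumes n: "n \<ge> 200" "a + b + 1 = n" "(11 / 20) * real n \<le> real a" "real a \<le> (13 / 20) * real n"
    and k: "k \<le> b" and lp: "l + p = a" and p: "2 * real l \<le> real a"
  shows "real (a choose 3) * real b - real (l choose 2) * real (k choose 2)
      - real (p choose 3) * real k \<ge> real n ^ 3 * (real l + (real b - real k)) / 500"
proof -
  define N where "N = real n"
  define Q0 where "Q0 = real (a choose 3)"
  define Q1 where "Q1 = real (l choose 2) * ((real b - 1) / 2) + real (p choose 3)"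
  have N: "N \<ge> 200" "real a + real b + 1 = N" "(11 / 20) * N \<le> real a" "real a \<le> (13 / 20) * N"
    using n by (auto simp: N_def)
  have N3: "0 \<le> N * N * N" using N by simp
  have l: "real a = real l + real p" using lp by simp
  have p11: "real p \<ge> (11 / 40) * N" using N p l by linarith
  have p12: "real p - 1 \<ge> (27 / 100) * N" using N p l by linarith
  have p13: "real p - 2 \<ge> (53 / 200) * N" using N p l by linarith
  have b11: "(real b - 1) / 2 \<ge> 0" using N by (simp add: field_simps)
  have b12: "(real b - 1) / 2 \<le> (9 / 40) * N" using N by (simp add: field_simps)
  have b13: "real b \<ge> (3 / 10) * N" using N by (simp add: field_simps)
  have "real p * (real p - 1) * (real p - 2) \<ge> ((11 / 40) * N) * ((27 / 100) * N) * ((53 / 200) * N)"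
    using p11 p12 p13 N by (intro mult_mono) auto
  then have "real (p choose 3) \<ge> N ^ 3 / 500"
    using N3 unfolding real_choose_3 power3_eq_cube by linarith
  moreover have "0 \<le> real (l choose 2) * ((real b - 1) / 2)" using b11 by simp
  ultimately have Q1: "Q1 \<ge> N ^ 3 / 500" unfolding Q1_def by linarith
  have Q01: "Q0 - Q1 \<ge> N\<^sup>2 * real l / 150"
  proof -
    have pa: "real p \<le> real a" using lp by simp
    have "((11 / 20) * N) * ((11 / 20) * N) \<le> real a * real a" using N by (intro mult_mono) auto
    then have e1: "(121 / 400) * (N * N) \<le> real a * real a" by simp
    have "((11 / 20) * N) * ((11 / 40) * N) \<le> real a * real p" using N p11 by (intro mult_mono) auto
    then have e2: "(121 / 800) * (N * N) \<le> real a * real p" by simp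
    have "((11 / 40) * N) * ((11 / 40) * N) \<le> real p * real p" using N p11 by (intro mult_mono) auto
    then have e3: "(121 / 1600) * (N * N) \<le> real p * real p" by simp
    define M where "M = N * N"
    have "M \<ge> 200 * N" unfolding M_def using N by (intro mult_right_mono) auto
    then have "3 * real a + 3 * real p - 2 \<le> (1 / 50) * M" using N(1,4) order_trans[OF pa N(4)] by linarith
    moreover have "0 \<le> M" by (simp add: M_def)
    ultimately have "real a * real a + real a * real p + real p * real p - (3 * real a + 3 * real p) + 2 \<ge> (1 / 2) * (N * N)"
      using e1 e2 e3 unfolding M_def by linarith
    then have "real l * (real a * real a + real a * real p + real p * real p - (3 * real a + 3 * real p) + 2) \<ge>
       real l * ((1 / 2) * (N * N))" by (rule mult_left_mono) simp
    moreover have "real (a choose 3) - real (p choose 3) =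
      real l * (real a * real a + real a * real p + real p * real p - (3 * real a + 3 * real p) + 2) / 6"
      unfolding real_choose_3 l by (simp add: field_simps)
    moreover have "real (l choose 2) * ((real b - 1) / 2) \<le> (real l * ((13 / 80) * N)) * ((9 / 40) * N)"
    proof -
      have "real l * ((real l - 1) / 2) \<le> real l * ((13 / 80) * N)"
        using N p by (intro mult_left_mono) auto
      then have "real (l choose 2) \<le> real l * ((13 / 80) * N)" by (simp add: real_choose_2)
      then show ?thesis using b11 b12 N by (intro mult_mono) auto
    qed
    moreover have "0 \<le> real l * (N * N)" by simp
    moreover have "real l * ((1 / 2) * (N * N)) = (1 / 2) * (real l * (N * N))"
      "(real l * ((13 / 80) * N)) * ((9 / 40) * N) = (117 / 3200) * (real l * (N * N))"
      "N\<^sup>2 * real l / 150 = (1 / 150) * (real l * (N * N))"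
      by (simp_all add: power2_eq_square)
    ultimately show ?thesis unfolding Q0_def Q1_def by linarith
  qed
  have F1: "real b * (Q0 - Q1) \<ge> ((3 / 10) * N) * (N\<^sup>2 * real l / 150)"
    using Q01 b13 N by (intro mult_mono) auto
  have "(real b - real k) * Q1 \<ge> (real b - real k) * (N ^ 3 / 500)"
    using Q1 k by (intro mult_left_mono) auto
  moreover have "real (l choose 2) * real (k choose 2) + real (p choose 3) * real k \<le> real k * Q1"
    unfolding Q1_def by (rule choose_bound_aux[OF k])
  moreover have "real (a choose 3) * real b = real b * Q0"
    unfolding Q0_def by simp
  moreover have "real b * (Q0 - Q1) = real b * Q0 - real b * Q1" "(real b - real k) * Q1 = real b * Q1 - real k * Q1"
    "((3 / 10) * N) * (N\<^sup>2 * real l / 150) = N ^ 3 * real l / 500"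
    "N ^ 3 * (real l + (real b - real k)) / 500 = N ^ 3 * real l / 500 + (real b - real k) * (N ^ 3 / 500)"
    by (simp_all add: algebra_simps add_divide_distrib diff_divide_distrib power3_eq_cube power2_eq_square)
  ultimately show ?thesis unfolding N_def[symmetric] using F1 by linarith
qed

text \<open>The copies avoiding \<open>v\<close> cancel by Pascal's rule, which leaves the gain
  lemmas with \<open>X\<close> and \<open>V - X\<close> stripped of \<open>v\<close>. If
  \<open>v\<close> lies in \<open>X\<close>, then \<open>card X = a + 1\<close>, whence the shift by
  1 in the bounds of \<open>gain_clique_vertex\<close>.\<close>

lemma gain_model:
  assumes V: "finite V" "X \<subseteq> V" "v \<in> V" and sym: "\<And>x y. R x y \<longleftrightarrow> R y x" and refl: "\<And>x. R x x"
    and n: "card V \<ge> 200"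
    and X: "(11 / 20) * real (card V) \<le> real (card X)" "real (card X) \<le> (13 / 20) * real (card V)"
    and bal: "2 * card {x \<in> X. R v x \<noteq> clique_rel X v x} \<le> card X"
  shows "real (card (copies (patch v R (clique_rel X)) V)) + real (card V) ^ 3 * real (card (badn R X V v)) / 500
    \<le> real (card (copies (clique_rel X) V))"
proof -
  define X' where "X' = X - {v}"
  define Y' where "Y' = V - X - {v}"
  define NX where "NX = {w \<in> X'. R v w}"
  define MX where "MX = {w \<in> X'. \<not> R v w}"
  define NY where "NY = {w \<in> Y'. R v w}"
  define MY where "MY = {w \<in> Y'. \<not> R v w}"
  have fin: "finite X" "finite X'" "finite Y'" "finite NX" "finite MX" "finite MY" "finite NY"
    using V by (auto simp: X'_def Y'_def NX_def MX_def MY_def NY_def intro: finite_subset)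
  have cX: "card NX + card MX = card X'"
    using fin by (subst card_Un_disjoint[symmetric]) (auto simp: NX_def MX_def intro: arg_cong[of _ _ card])
  have cY: "card NY + card MY = card Y'"
    using fin by (subst card_Un_disjoint[symmetric]) (auto simp: NY_def MY_def intro: arg_cong[of _ _ card])
  have "V = insert v (X' \<union> Y')" using V by (auto simp: X'_def Y'_def)
  also have "card \<dots> = card X' + card Y' + 1"
    using fin by (subst card_insert_disjoint) (auto simp: X'_def Y'_def intro!: card_Un_disjoint)
  finally have cV: "card X' + card Y' + 1 = card V" by simp
  note le = card_copies_patch_clique_rel_le[of V X R v, OF V(1,2) sym, folded X'_def Y'_def, folded NX_def MX_def MY_def]
  have le': "real (card (copies (patch v R (clique_rel X)) V)) \<le>
    real (card X' choose 3) * real (card Y' choose 2) +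
    (real (card NX choose 2) * real (card MY choose 2) + real (card MX choose 3) * real (card MY))"
    using le by (simp flip: of_nat_mult of_nat_add)
  have eq: "real (card (copies (clique_rel X) V)) = real (card X choose 3) * real (card (V - X) choose 2)"
    using card_copies_clique_rel[OF V(1,2)] by simp
  show ?thesis
  proof (cases "v \<in> X")
    case True
    have aX: "card X = card X' + 1" using True fin card_Suc_Diff1[of X v] by (simp add: X'_def)
    have YY: "V - X = Y'" using True by (auto simp: Y'_def)
    have "{x \<in> X. R v x \<noteq> clique_rel X v x} = MX" using True refl by (auto simp: MX_def X'_def clique_rel_def)
    then have p: "2 * real (card MX) \<le> real (card X') + 1" using bal aX by simp
    have "badn R X V v = MX \<union> NY" using True refl V by (auto simp: badn_def MX_def X'_def NY_def Y'_def clique_rel_def)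
    also have "card \<dots> = card MX + card NY"
      using fin by (intro card_Un_disjoint) (auto simp: MX_def X'_def NY_def Y'_def)
    finally have d: "real (card (badn R X V v)) = real (card MX) + (real (card Y') - real (card MY))"
      using cY by simp
    have ch: "real ((card X' + 1) choose 3) = real (card X' choose 3) + real (card X' choose 2)"
      by (simp add: eval_nat_numeral)
    note g = gain_clique_vertex[OF n cV _ _ _ cX p, of "card MY"]
    show ?thesis using g le' X cY unfolding eq YY d aX ch by (simp add: algebra_simps)
  next
    case False
    have aX: "card X = card X'" using False by (simp add: X'_def)
    have YY: "card (V - X) = card Y' + 1"
      using False V card_Suc_Diff1[of "V - X" v] by (simp add: Y'_def)
    have "{x \<in> X. R v x \<noteq> clique_rel X v x} = NX" using False by (auto simp: NX_def X'_def clique_rel_def)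
    then have p: "2 * real (card NX) \<le> real (card X')" using bal aX by simp
    have "badn R X V v = NX \<union> NY" using False refl V by (auto simp: badn_def NX_def X'_def NY_def Y'_def clique_rel_def)
    also have "card \<dots> = card NX + card NY"
      using fin by (intro card_Un_disjoint) (auto simp: NX_def X'_def NY_def Y'_def)
    finally have d: "real (card (badn R X V v)) = real (card NX) + (real (card Y') - real (card MY))"
      using cY by simp
    have ch: "real ((card Y' + 1) choose 2) = real (card Y' choose 2) + real (card Y')"
      by (simp add: eval_nat_numeral)
    note g = gain_isolated_vertex[OF n cV _ _ _ cX p, of "card MY"]
    show ?thesis using g le' X cY unfolding eq YY d aX ch by (simp add: algebra_simps)
  qed
qed

text \<open>The exchange inequality \<open>card_copies_patch\<close> turns the loss suffered by the
  model when rewired at \<open>v\<close> into a gain for \<open>R\<close> when corrected at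
  \<open>v\<close>. Half of the rate 1/500 survives: 5-sets with wrong pairs both at
  \<open>v\<close> and away from it cost at most the other half.\<close>

lemma gain_vertex:
  assumes V: "finite V" "X \<subseteq> V" "v \<in> V" and sym: "\<And>x y. R x y \<longleftrightarrow> R y x" and refl: "\<And>x. R x x"
    and n: "card V \<ge> 200"
    and X: "(11 / 20) * real (card V) \<le> real (card X)" "real (card X) \<le> (13 / 20) * real (card V)"
    and bal: "2 * card {x \<in> X. R v x \<noteq> clique_rel X v x} \<le> card X"
    and max: "\<And>w. w \<in> V \<Longrightarrow> card (badn R X V w) \<le> card (badn R X V v)"
    and close: "real (card (bad R X V)) \<le> (real (card V) / 4000)\<^sup>2"
  shows "real (card (copies R V)) + real (card V) ^ 3 * real (card (badn R X V v)) / 1000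
    \<le> real (card (copies (patch v (clique_rel X) R) V))"
proof -
  define N where "N = real (card V)"
  define d where "d = real (card (badn R X V v))"
  define D where "D = real (card (bad R X V))"
  define S where "S = (\<Sum>w\<in>badn R X V v. card (badn R X V w))"
  let ?dirty = "card {S. S \<subseteq> V \<and> card S = 5 \<and> v \<in> S \<and> (\<exists>w\<in>S. R v w \<noteq> clique_rel X v w) \<and>
      (\<exists>x\<in>S - {v}. \<exists>y\<in>S - {v}. R x y \<noteq> clique_rel X x y)}"
  have N: "N \<ge> 200" using n by (simp add: N_def)
  have D: "D \<le> (N / 4000)\<^sup>2" using close by (simp add: D_def N_def)
  have "S \<le> card (badn R X V v) * card (badn R X V v)"
    unfolding S_def using sum_bounded_above[of "badn R X V v" "\<lambda>w. card (badn R X V w)"] max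
    by (auto simp: badn_def)
  then have S1: "real S \<le> d * d" unfolding d_def by (simp flip: of_nat_mult)
  have "S \<le> card (bad R X V)"
    unfolding S_def card_bad_eq_sum[OF V(1)] using V by (intro sum_mono2) (auto simp: badn_def)
  then have S2: "real S \<le> D" by (simp add: D_def)
  have d0: "d \<ge> 0" by (simp add: d_def)
  \<comment> \<open>\<open>S\<close> is at most \<open>d * d\<close> by the choice of
    \<open>v\<close>, and at most \<open>D\<close>. The first bound is used for
    \<open>d \<le> N / 4000\<close>, the second above that.\<close>
  have S3: "real S \<le> d * (N / 4000)"
  proof (cases "d \<le> N / 4000")
    case True
    then have "d * d \<le> d * (N / 4000)" using d0 by (intro mult_left_mono) auto
    then show ?thesis using S1 by linarith
  next
    case False
    then have "(N / 4000) * (N / 4000) \<le> d * (N / 4000)" using N by (intro mult_right_mono) auto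
    then show ?thesis using S2 D by (simp add: power2_eq_square)
  qed
  have "real ?dirty \<le> d * D * N + real S * N\<^sup>2"
    using card_double_bad_le[of V R v X, OF V(1) sym refl]
    unfolding d_def D_def N_def S_def by (simp flip: of_nat_mult of_nat_add of_nat_power of_nat_sum)
  moreover have "d * D * N \<le> d * (N / 4000)\<^sup>2 * N"
    using D d0 N by (intro mult_right_mono mult_left_mono) auto
  moreover have "real S * N\<^sup>2 \<le> d * (N / 4000) * N\<^sup>2" using S3 by (rule mult_right_mono) simp
  moreover have "d * (N / 4000)\<^sup>2 * N = d * N ^ 3 / 16000000" "d * (N / 4000) * N\<^sup>2 = d * N ^ 3 / 4000"
    by (simp_all add: power2_eq_square power3_eq_cube)
  moreover have "0 \<le> d * N ^ 3" using d0 N by simp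
  ultimately have "2 * real ?dirty \<le> d * N ^ 3 / 1000" by linarith
  then have dirty: "2 * real ?dirty \<le> N ^ 3 * d / 1000" by (simp add: mult.commute)
  have "real (card (copies R V)) + real (card (copies (clique_rel X) V)) \<le>
    real (card (copies (patch v (clique_rel X) R) V)) + real (card (copies (patch v R (clique_rel X)) V)) + 2 * real ?dirty"
    using card_copies_patch[of V R "clique_rel X" v, OF V(1) sym clique_rel_sym] by linarith
  moreover have "real (card (copies (patch v R (clique_rel X)) V)) + N ^ 3 * d / 500
    \<le> real (card (copies (clique_rel X) V))"
    unfolding N_def d_def by (rule gain_model[OF V sym refl n X bal])
  ultimately show ?thesis using dirty unfolding N_def[symmetric] d_def[symmetric] by linarith
qed

text \<open>Correcting a vertex with the largest number d of wrong pairs gains d n^3 / 1000 copies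
  and removes at most 2 d ordered wrong pairs, which gives the rate 1/2000. A correction creates no
  new wrong pair, so the balance and closeness conditions are inherited.\<close>

lemma local_stability:
  assumes V: "finite V" "X \<subseteq> V" and sym: "\<And>x y. R x y \<longleftrightarrow> R y x" and refl: "\<And>x. R x x"
    and n: "card V \<ge> 200"
    and X: "(11 / 20) * real (card V) \<le> real (card X)" "real (card X) \<le> (13 / 20) * real (card V)"
    and bal: "\<And>w. w \<in> V \<Longrightarrow> 2 * card {x \<in> X. R w x \<noteq> clique_rel X w x} \<le> card X"
    and close: "real (card (bad R X V)) \<le> (real (card V) / 4000)\<^sup>2"
  shows "real (card (copies R V)) + real (card V) ^ 3 * real (card (bad R X V)) / 2000
    \<le> real (card (copies (clique_rel X) V))"
  using sym refl bal close
proof (induction "card (bad R X V)" arbitrary: R rule: less_induct)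
  case (less R)
  have finX: "finite X" using V finite_subset by auto
  show ?case
  proof (cases "bad R X V = {}")
    case True
    then have "copies R V = copies (clique_rel X) V"
      by (intro copies_cong_on) (auto simp: bad_def)
    then show ?thesis using True by simp
  next
    case False
    then have Vne: "V \<noteq> {}" by (auto simp: bad_def)
    define f where "f w = card (badn R X V w)" for w
    obtain v where v: "v \<in> V" and max: "\<And>w. w \<in> V \<Longrightarrow> f w \<le> f v"
    proof -
      have "Max (f ` V) \<in> f ` V" using V(1) Vne by (intro Max_in) auto
      then obtain v where "v \<in> V" "f v = Max (f ` V)" by (metis imageE)
      then show ?thesis using that[of v] V(1) by simp
    qed
    let ?R' = "patch v (clique_rel X) R"
    let ?W = "badn R X V v"
    have W: "finite ?W" "?W \<noteq> {}"
    proof -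
      show "finite ?W" using V by (simp add: finite_badn)
      show "?W \<noteq> {}"
      proof
        assume "?W = {}"
        then have "f w = 0" if "w \<in> V" for w using max[OF that] by (simp add: f_def)
        then have "card (bad R X V) = 0" using V by (simp add: card_bad_eq_sum f_def)
        then show False using False V by (simp add: finite_bad)
      qed
    qed
    have sub: "bad ?R' X V \<subseteq> bad R X V" by (auto simp: bad_def patch_def)
    have sub2: "bad R X V \<subseteq> bad ?R' X V \<union> ({v} \<times> ?W \<union> ?W \<times> {v})"
    proof (rule subrelI)
      fix x y assume xy: "(x, y) \<in> bad R X V"
      then have "x \<in> V" "y \<in> V" "R x y \<noteq> clique_rel X x y" by (simp_all add: bad_def)
      moreover from this(3) have "R y x \<noteq> clique_rel X y x"
        using less.prems(1) clique_rel_sym by metis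
      ultimately have "x = v \<Longrightarrow> y \<in> ?W" "y = v \<Longrightarrow> x \<in> ?W" by (simp_all add: badn_def)
      then show "(x, y) \<in> bad ?R' X V \<union> ({v} \<times> ?W \<union> ?W \<times> {v})"
        using xy by (cases "x = v \<or> y = v") (auto simp: bad_def patch_def)
    qed
    obtain w where w: "w \<in> ?W" using W by blast
    then have "(v, w) \<in> bad R X V" "(v, w) \<notin> bad ?R' X V"
      using v by (auto simp: bad_def badn_def patch_def)
    then have "bad ?R' X V \<subset> bad R X V" using sub by blast
    then have lt: "card (bad ?R' X V) < card (bad R X V)"
      using V by (intro psubset_card_mono) (auto simp: finite_bad)
    have "card (bad R X V) \<le> card (bad ?R' X V \<union> ({v} \<times> ?W \<union> ?W \<times> {v}))"
      using sub2 V W by (intro card_mono) (auto simp: finite_bad)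
    also have "\<dots> \<le> card (bad ?R' X V) + (card ({v} \<times> ?W) + card (?W \<times> {v}))"
      by (meson card_Un_le add_left_mono le_trans)
    also have "\<dots> = card (bad ?R' X V) + 2 * card ?W" by (simp add: card_cartesian_product)
    finally have "card (bad R X V) \<le> card (bad ?R' X V) + 2 * card ?W" .
    then have "real (card (bad R X V)) \<le> real (card (bad ?R' X V)) + 2 * real (card ?W)" by linarith
    then have "real (card V) ^ 3 * real (card (bad R X V)) \<le>
        real (card V) ^ 3 * (real (card (bad ?R' X V)) + 2 * real (card ?W))"
      by (intro mult_left_mono) auto
    moreover have "real (card (copies R V)) + real (card V) ^ 3 * real (card ?W) / 1000
      \<le> real (card (copies ?R' V))"
      by (rule gain_vertex[OF V v less.prems(1,2) n X less.prems(3)[OF v] max[unfolded f_def] less.prems(4)])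
    moreover have "real (card (copies ?R' V)) + real (card V) ^ 3 * real (card (bad ?R' X V)) / 2000
      \<le> real (card (copies (clique_rel X) V))"
    proof (rule less.hyps[OF lt])
      show "?R' x y \<longleftrightarrow> ?R' y x" for x y
        using less.prems(1)[of x y] clique_rel_sym[of X x y] by (auto simp: patch_def)
      show "?R' x x" for x using less.prems(2) by (simp add: patch_def clique_rel_refl)
      show "2 * card {x \<in> X. ?R' w x \<noteq> clique_rel X w x} \<le> card X" if "w \<in> V" for w
      proof -
        have "card {x \<in> X. ?R' w x \<noteq> clique_rel X w x} \<le> card {x \<in> X. R w x \<noteq> clique_rel X w x}"
          using finX by (intro card_mono) (auto simp: patch_def)
        then show ?thesis using less.prems(3)[OF that] by linarith
      qed
      show "real (card (bad ?R' X V)) \<le> (real (card V) / 4000)\<^sup>2" using lt less.prems(4) by linarith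
    qed
    ultimately show ?thesis by (simp add: algebra_simps)
  qed
qed

subsection \<open>Global stability\<close>

text \<open>Moving \<open>w\<close> into or out of \<open>X\<close> changes the model exactly on the
  pairs joining \<open>w\<close> to the other members of \<open>X\<close>, where wrong and correct
  pairs swap roles. By minimality the wrong ones do not outnumber the correct ones.\<close>

lemma minimal_bad_balanced:
  assumes V: "finite V" "X \<subseteq> V" "w \<in> V" and sym: "\<And>x y. R x y \<longleftrightarrow> R y x" and refl: "\<And>x. R x x"
    and min: "\<And>X'. X' \<subseteq> V \<Longrightarrow> card (bad R X V) \<le> card (bad R X' V)"
  shows "2 * card {x \<in> X. R w x \<noteq> clique_rel X w x} \<le> card X"
proof -
  define X' where "X' = (if w \<in> X then X - {w} else insert w X)"
  define M where "M = {x \<in> X. R w x \<noteq> clique_rel X w x}"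
  define M' where "M' = {x \<in> X - {w}. R w x \<noteq> clique_rel X' w x}"
  define K where "K = bad R X V \<inter> bad R X' V"
  have fin: "finite X" "finite M" "finite M'" "finite K"
    using V by (auto simp: M_def M'_def K_def finite_bad intro: finite_subset)
  have X': "X' \<subseteq> V" using V by (auto simp: X'_def)
  have wM: "w \<notin> M" "w \<notin> M'" using refl by (auto simp: M_def M'_def clique_rel_def)
  have cM: "card M + card M' \<le> card X"
  proof -
    have "M \<inter> M' = {}" by (auto simp: M_def M'_def X'_def clique_rel_def)
    then have "card M + card M' = card (M \<union> M')" using fin by (simp add: card_Un_disjoint)
    also have "\<dots> \<le> card X" using fin by (intro card_mono) (auto simp: M_def M'_def)
    finally show ?thesis .
  qed
  have sub: "K \<union> ({w} \<times> M \<union> M \<times> {w}) \<subseteq> bad R X V"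
  proof -
    have "(w, x) \<in> bad R X V \<and> (x, w) \<in> bad R X V" if "x \<in> M" for x
      using that V sym[of w x] clique_rel_sym[of X w x] by (auto simp: M_def bad_def)
    then show ?thesis by (auto simp: K_def)
  qed
  have sub': "bad R X' V \<subseteq> K \<union> ({w} \<times> M' \<union> M' \<times> {w})"
  proof (rule subrelI)
    fix x y assume xy: "(x, y) \<in> bad R X' V"
    then have *: "x \<in> V" "y \<in> V" "R x y \<noteq> clique_rel X' x y" by (simp_all add: bad_def)
    have **: "R y x \<noteq> clique_rel X' y x" using *(3) sym clique_rel_sym by metis
    show "(x, y) \<in> K \<union> ({w} \<times> M' \<union> M' \<times> {w})"
    proof (cases "clique_rel X x y = clique_rel X' x y")
      case True
      then show ?thesis using xy by (auto simp: K_def bad_def)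
    next
      case False
      then have "x = w \<and> y \<in> X - {w} \<or> y = w \<and> x \<in> X - {w}"
        by (auto simp: clique_rel_def X'_def split: if_splits)
      then show ?thesis using * ** by (auto simp: M'_def)
    qed
  qed
  have "K \<inter> ({w} \<times> M \<union> M \<times> {w}) = {}"
    using refl by (auto simp: K_def M_def bad_def X'_def clique_rel_def split: if_splits)
  then have "card K + 2 * card M = card (K \<union> ({w} \<times> M \<union> M \<times> {w}))"
    using fin wM by (subst card_Un_disjoint, simp, simp, simp, subst card_Un_disjoint)
      (auto simp: card_cartesian_product)
  also have "\<dots> \<le> card (bad R X V)" using sub V by (intro card_mono) (auto simp: finite_bad)
  also have "\<dots> \<le> card (bad R X' V)" by (rule min[OF X'])
  also have "\<dots> \<le> card (K \<union> ({w} \<times> M' \<union> M' \<times> {w}))" using sub' fin by (intro card_mono) auto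
  also have "\<dots> \<le> card K + (card ({w} \<times> M') + card (M' \<times> {w}))"
    by (meson card_Un_le add_left_mono le_trans)
  also have "\<dots> = card K + 2 * card M'" by (simp add: card_cartesian_product)
  finally show ?thesis using cM unfolding M_def by linarith
qed

lemma card_bad_clone:
  assumes V: "finite V" "u \<in> V"
  shows "card (bad R X V) \<le> card (bad (clone R u v) X V) + 2 * card V"
proof -
  have "bad R X V \<subseteq> bad (clone R u v) X V \<union> ({u} \<times> V \<union> V \<times> {u})"
    by (auto simp: bad_def clone_def)
  then have "card (bad R X V) \<le> card (bad (clone R u v) X V \<union> ({u} \<times> V \<union> V \<times> {u}))"
    using V by (intro card_mono) (auto simp: finite_bad)
  also have "\<dots> \<le> card (bad (clone R u v) X V) + (card ({u} \<times> V) + card (V \<times> {u}))"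
    by (meson card_Un_le add_left_mono le_trans)
  finally show ?thesis by (simp add: card_cartesian_product)
qed

lemma card_copies_clique_rel_le:
  assumes V: "finite V" "V \<noteq> {}" "X \<subseteq> V"
  defines "y \<equiv> real (card X) / real (card V)"
  shows "real (card (copies (clique_rel X) V)) \<le> real (card V) ^ 5 / 12 * (y ^ 3 * (1 - y)\<^sup>2)"
proof -
  have n: "real (card V) > 0" using V by (simp add: card_gt_0_iff)
  have c: "real (card (V - X)) = real (card V) * (1 - y)"
    using V n by (simp add: y_def card_Diff_subset finite_subset of_nat_diff card_mono field_simps)
  have "real (card (V - X)) * (real (card (V - X)) - 1) \<le> real (card (V - X)) * real (card (V - X))"
    by (intro mult_left_mono) auto
  then have "real (card (V - X) choose 2) \<le> (real (card (V - X)))\<^sup>2 / 2"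
    by (simp add: real_choose_2 power2_eq_square)
  then have "real (card X choose 3) * real (card (V - X) choose 2) \<le>
      (real (card X) ^ 3 / 6) * ((real (card (V - X)))\<^sup>2 / 2)"
    by (intro mult_mono real_choose_3_le) auto
  also have "\<dots> = real (card V) ^ 5 / 12 * (y ^ 3 * (1 - y)\<^sup>2)"
  proof -
    have x: "real (card X) = real (card V) * y" using n by (simp add: y_def)
    show ?thesis unfolding c x by (simp add: power_mult_distrib eval_nat_numeral)
  qed
  finally show ?thesis by (simp add: card_copies_clique_rel[OF V(1,3)])
qed

text \<open>A set \<open>X\<close> with fewest wrong pairs is balanced. Passing to its model costs
  at most \<open>D * N ^ 3\<close> copies, which pins the proportion of \<open>X\<close> near 3/5,
  so \<open>local_stability\<close> applies. Since no relation has more than 9/3125 N^5 copies, N^3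
  D / 2000 \<le> N^5 / 10^11 follows. Thus D \<le> N^2 / (5 * 10^7), whereas half of the window is
  N^2 / (3.2 * 10^7).\<close>

lemma improve_closeness:
  assumes V: "finite V" and sym: "\<And>x y. R x y \<longleftrightarrow> R y x" and refl: "\<And>x. R x x"
    and n: "card V \<ge> 200"
    and large: "real (card (copies R V)) \<ge> (9 / 3125 - 1 / 10 ^ 11) * real (card V) ^ 5"
    and X0: "X0 \<subseteq> V" "real (card (bad R X0 V)) \<le> (real (card V) / 4000)\<^sup>2"
  obtains X where "X \<subseteq> V" "X \<noteq> {}" "real (card (bad R X V)) \<le> (real (card V) / 4000)\<^sup>2 / 2"
    "real (card (copies R V)) + real (card V) ^ 3 * real (card (bad R X V)) / 2000
      \<le> real (card (copies (clique_rel X) V))"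
proof -
  define N where "N = real (card V)"
  have N: "N \<ge> 200" using n by (simp add: N_def)
  have Vne: "V \<noteq> {}" using n by auto
  obtain X where X: "X \<subseteq> V" and min: "\<And>X'. X' \<subseteq> V \<Longrightarrow> card (bad R X V) \<le> card (bad R X' V)"
  proof -
    have "\<exists>X. X \<in> Pow V \<and> (\<forall>X'. X' \<in> Pow V \<longrightarrow> card (bad R X V) \<le> card (bad R X' V))"
      by (rule ex_has_least_nat[of "\<lambda>X. X \<in> Pow V" V]) simp
    then show ?thesis using that by auto
  qed
  define D where "D = real (card (bad R X V))"
  define y where "y = real (card X) / N"
  have D: "D \<le> (N / 4000)\<^sup>2"
    using min[OF X0(1)] X0(2) unfolding D_def N_def by linarith
  have "card (copies R V) \<le> card (copies (clique_rel X) V) + card (bad R X V) * card V ^ 3"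
    using card_copies_le_add_disagree[OF V, of R "clique_rel X"]
      card_disagree_le[of V R "clique_rel X", OF V refl clique_rel_refl]
    unfolding bad_def by linarith
  then have "real (card (copies R V)) \<le> real (card (copies (clique_rel X) V)) + D * N ^ 3"
    unfolding D_def N_def by (simp flip: of_nat_mult of_nat_add of_nat_power)
  moreover have "D * N ^ 3 \<le> (N / 4000)\<^sup>2 * N ^ 3" using D N by (intro mult_right_mono) auto
  moreover have "(N / 4000)\<^sup>2 * N ^ 3 = N ^ 5 / 16000000" by (simp add: power2_eq_square eval_nat_numeral)
  moreover have "real (card (copies (clique_rel X) V)) \<le> N ^ 5 / 12 * (y ^ 3 * (1 - y)\<^sup>2)"
    using card_copies_clique_rel_le[OF V Vne X] by (simp add: N_def y_def)
  ultimately have "(9 / 3125 - 1 / 10 ^ 11) * N ^ 5 \<le> N ^ 5 / 12 * (y ^ 3 * (1 - y)\<^sup>2) + N ^ 5 / 16000000"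
    using large unfolding N_def by linarith
  then have "N ^ 5 * (9 / 3125 - 1 / 10 ^ 11) \<le> N ^ 5 * ((y ^ 3 * (1 - y)\<^sup>2) / 12 + 1 / 16000000)"
    by (simp add: algebra_simps)
  then have "9 / 3125 - 1 / 10 ^ 11 \<le> (y ^ 3 * (1 - y)\<^sup>2) / 12 + 1 / 16000000"
    using N by (subst (asm) mult_le_cancel_left_pos) auto
  moreover have "y ^ 3 * (1 - y)\<^sup>2 \<le> 108 / 3125 - 12 / 125 * (y - 3 / 5)\<^sup>2"
    using N V X by (intro pow3_mult_sq_le) (auto simp: y_def N_def card_mono)
  \<comment> \<open>1/400 = (1/20)^2, where 1/20 is the tolerance around 3/5 in the gain
    lemmas.\<close>
  moreover have "s \<le> 1 / 400"
    if "9 / 3125 - 1 / 10 ^ 11 \<le> t / 12 + 1 / 16000000" "t \<le> 108 / 3125 - 12 / 125 * s" for s t :: real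
    using that by simp
  ultimately have "(y - 3 / 5)\<^sup>2 \<le> 1 / 400" by blast
  then have "(y - 3 / 5)\<^sup>2 \<le> (1 / 20)\<^sup>2" by (simp add: power_divide)
  then have "\<bar>y - 3 / 5\<bar> \<le> 1 / 20" by (simp only: abs_le_square_iff[symmetric])
  then have "11 / 20 \<le> y" "y \<le> 13 / 20" by linarith+
  then have range: "11 / 20 * N \<le> real (card X)" "real (card X) \<le> 13 / 20 * N"
    using N by (simp_all add: y_def field_simps)
  have loc: "real (card (copies R V)) + N ^ 3 * D / 2000 \<le> real (card (copies (clique_rel X) V))"
    unfolding N_def D_def
    by (rule local_stability[OF V X sym refl n])
      (use range D minimal_bad_balanced[of V X _ R, OF V X _ sym refl min] in \<open>auto simp: N_def D_def\<close>)
  have "real (card (copies (clique_rel X) V)) \<le> 9 / 3125 * N ^ 5"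
    unfolding N_def by (rule card_copies_le[OF V clique_rel_sym clique_rel_refl])
  then have "N ^ 3 * D / 2000 \<le> N ^ 5 / 10 ^ 11"
    using loc large unfolding N_def[symmetric] by (simp add: algebra_simps)
  then have "N ^ 3 * D \<le> N ^ 3 * (N\<^sup>2 / 50000000)" by (simp add: power2_eq_square eval_nat_numeral mult_ac)
  then have "D \<le> N\<^sup>2 / 50000000" using N by (subst (asm) mult_le_cancel_left_pos) auto
  also have "\<dots> \<le> (N / 4000)\<^sup>2 / 2" by (simp add: power2_eq_square)
  finally have "D \<le> (N / 4000)\<^sup>2 / 2" .
  moreover have "X \<noteq> {}" using range N by auto
  ultimately show ?thesis using that[OF X] loc unfolding D_def N_def by blast
qed

text \<open>The dominant class serves as \<open>X\<close>. Wrong pairs then lie inside the other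
  classes, so there are at most n^2 times the sum of their squared proportions. A deficit of n^5 /
  10^11 copies is 12 / 10^11 in \<open>part_poly\<close>, and the coefficient 1/25 turns this into
  300 / 10^11.\<close>

lemma equivalence_close:
  assumes V: "finite V" "V \<noteq> {}" and sym: "\<And>x y. R x y \<longleftrightarrow> R y x" and refl: "\<And>x. R x x"
    and trans: "\<forall>x\<in>V. \<forall>y\<in>V. \<forall>z\<in>V. R x y \<longrightarrow> R y z \<longrightarrow> R x z"
    and large: "real (card (copies R V)) \<ge> (9 / 3125 - 1 / 10 ^ 11) * real (card V) ^ 5"
  obtains X where "X \<subseteq> V" "real (card (bad R X V)) \<le> (real (card V) / 4000)\<^sup>2 / 2"
proof -
  define n where "n = real (card V)"
  have n: "n > 0" using V by (simp add: n_def card_gt_0_iff)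
  obtain P where P: "partition_on V P"
    and R: "\<And>x y. x \<in> V \<Longrightarrow> y \<in> V \<Longrightarrow> R x y \<longleftrightarrow> (\<exists>A\<in>P. x \<in> A \<and> y \<in> A)"
    by (rule partition_of_equivalence[OF sym refl trans]) blast
  define x where "x A = real (card A) / real (card V)" for A :: "'a set"
  note le = card_copies_partition_le[OF V P R, folded x_def]
  have x0: "0 \<le> x A" for A by (simp add: x_def)
  have "n ^ 5 * (9 / 3125 - 1 / 10 ^ 11) \<le> n ^ 5 * (part_poly x P / 12)"
    using le(1) large by (simp add: n_def mult.commute)
  then have f: "108 / 3125 - 12 / 10 ^ 11 \<le> part_poly x P"
    using n by (subst (asm) mult_le_cancel_left_pos) auto
  then have "1 / 32 < part_poly x P" by simp
  then obtain M where M: "M \<in> P" and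
    "part_poly x P \<le> 108 / 3125 - 12 / 125 * (x M - 3 / 5)\<^sup>2 - 1 / 25 * (\<Sum>A\<in>P - {M}. (x A)\<^sup>2)"
    using part_poly_stability[OF le(2) x0 le(3)] by metis
  moreover have "0 \<le> (x M - 3 / 5)\<^sup>2" by simp
  ultimately have q: "(\<Sum>A\<in>P - {M}. (x A)\<^sup>2) \<le> 300 / 10 ^ 11" using f by linarith
  have UP: "\<Union>P = V" and disj: "\<And>A B. A \<in> P \<Longrightarrow> B \<in> P \<Longrightarrow> A \<noteq> B \<Longrightarrow> A \<inter> B = {}"
    using P by (auto simp: partition_on_def disjoint_def)
  have finA: "finite A" if "A \<in> P" for A using that UP V by (auto intro: finite_subset)
  have "bad R M V \<subseteq> (\<Union>A\<in>P - {M}. A \<times> A)"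
  proof (rule subrelI)
    fix a b assume "(a, b) \<in> bad R M V"
    then have ab: "a \<in> V" "b \<in> V" "R a b \<noteq> clique_rel M a b" by (auto simp: bad_def)
    have "R a b"
    proof (rule ccontr)
      assume "\<not> R a b"
      then have "clique_rel M a b" using ab by simp
      then show False using \<open>\<not> R a b\<close> refl R[OF ab(1,2)] M by (auto simp: clique_rel_def)
    qed
    then obtain A where "A \<in> P" "a \<in> A" "b \<in> A" using R[OF ab(1,2)] by blast
    moreover have "A \<noteq> M" using \<open>R a b\<close> ab(3) calculation by (auto simp: clique_rel_def)
    ultimately show "(a, b) \<in> (\<Union>A\<in>P - {M}. A \<times> A)" by blast
  qed
  then have "card (bad R M V) \<le> card (\<Union>A\<in>P - {M}. A \<times> A)"
    using le(2) finA by (intro card_mono) auto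
  also have "\<dots> \<le> (\<Sum>A\<in>P - {M}. card (A \<times> A))" using le(2) by (intro card_UN_le) auto
  finally have "real (card (bad R M V)) \<le> real (\<Sum>A\<in>P - {M}. card (A \<times> A))" by (rule of_nat_mono)
  also have "\<dots> = n\<^sup>2 * (\<Sum>A\<in>P - {M}. (x A)\<^sup>2)"
    using n by (simp add: card_cartesian_product sum_distrib_left x_def n_def power2_eq_square)
  also have "\<dots> \<le> n\<^sup>2 * (300 / 10 ^ 11)" using q by (intro mult_left_mono) auto
  also have "\<dots> \<le> (n / 4000)\<^sup>2 / 2" by (simp add: power2_eq_square)
  finally have "real (card (bad R M V)) \<le> (n / 4000)\<^sup>2 / 2" .
  moreover have "M \<subseteq> V" using M UP by auto
  ultimately show ?thesis using that unfolding n_def by blast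
qed

text \<open>Closeness is carried backwards along the symmetrisation: undoing one step costs at most
  \<open>2 * card V\<close> bad pairs, which the local analysis regains.\<close>

lemma relation_stability:
  assumes V: "finite V" and n: "card V \<ge> 10 ^ 8"
    and sym: "\<And>x y. R x y \<longleftrightarrow> R y x" and refl: "\<And>x. R x x"
    and large: "real (card (copies R V)) \<ge> (9 / 3125 - 1 / 10 ^ 11) * real (card V) ^ 5"
  obtains X where "X \<subseteq> V" "X \<noteq> {}"
    "real (card (copies R V)) + real (card V) ^ 3 * real (card (bad R X V)) / 2000
      \<le> real (card (copies (clique_rel X) V))"
proof -
  have n200: "card V \<ge> 200" using n by simp
  have Vne: "V \<noteq> {}" using n by auto
  have N: "real (card V) \<ge> 10 ^ 8" using n by (metis of_nat_le_iff of_nat_numeral of_nat_power)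
  have half: "(real (card V) / 4000)\<^sup>2 / 2 \<le> (real (card V) / 4000)\<^sup>2" by simp
  \<comment> \<open>The hypothesis \<open>large\<close> is part of the induction claim; it passes to
    \<open>clone R u v\<close>, which has at least as many copies. The factor 1/2 reserves room for
    the wrong pairs of one step.\<close>
  have "\<exists>X\<subseteq>V. real (card (bad R X V)) \<le> (real (card V) / 4000)\<^sup>2 / 2"
    using V sym refl large
  proof (induction rule: symmetrisation_induct)
    case (equivalence R)
    then show ?case using equivalence_close[OF V Vne, of R] by metis
  next
    case (clone R u v)
    have "(9 / 3125 - 1 / 10 ^ 11) * real (card V) ^ 5 \<le> real (card (copies (clone R u v) V))"
      using clone.prems clone.hyps(5) by linarith
    then obtain X0 where X0: "X0 \<subseteq> V" "real (card (bad (clone R u v) X0 V)) \<le> (real (card V) / 4000)\<^sup>2 / 2"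
      using clone.IH by blast
    have "real (card (bad R X0 V)) \<le> real (card (bad (clone R u v) X0 V)) + 2 * real (card V)"
      using card_bad_clone[OF V clone.hyps(3), of R X0 v] by linarith
    also have "\<dots> \<le> (real (card V) / 4000)\<^sup>2"
    proof -
      \<comment> \<open>Writing n for \<open>card V\<close>, 2 n fits into half of the window, n^2 /
        (3.2 * 10^7), once n \<ge> 6.4 * 10^7.\<close>
      have "10 ^ 8 * real (card V) \<le> real (card V) * real (card V)" using N by (intro mult_right_mono) auto
      then show ?thesis using X0(2) by (simp add: power2_eq_square)
    qed
    finally show ?case
      using improve_closeness[of V R X0, OF V clone.hyps(1,2) n200 clone.prems X0(1)] by metis
  qed
  then obtain X0 where "X0 \<subseteq> V" "real (card (bad R X0 V)) \<le> (real (card V) / 4000)\<^sup>2"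
    using half order_trans by blast
  then show ?thesis
    using improve_closeness[of V R X0, OF V sym refl n200 large] that by metis
qed

subsection \<open>Transfer to graphs\<close>

definition nonadj :: "graph \<Rightarrow> nat \<Rightarrow> nat \<Rightarrow> bool" where
  "nonadj G x y \<longleftrightarrow> {x, y} \<notin> edges G"

lemma nonadj_sym: "nonadj G x y \<longleftrightarrow> nonadj G y x"
  by (simp add: nonadj_def insert_commute)

lemma nonadj_refl: "is_graph G \<Longrightarrow> nonadj G x x"
  by (force simp: nonadj_def is_graph_def)

lemma edge_complete_partite_graph_iff:
  "{x, y} \<in> edges (complete_partite_graph \<P>) \<longleftrightarrow> (\<exists>A\<in>\<P>. \<exists>B\<in>\<P>. A \<noteq> B \<and> x \<in> A \<and> y \<in> B)"
  unfolding complete_partite_graph_def by (auto simp: doubleton_eq_iff) blast+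

section \<open>Induced copies of \<open>K311\<close> and copies in the complement relation\<close>

lemma verts_K311: "verts K311 = {0, 1, 2, 3, 4}"
  by (auto simp: K311_def complete_partite_graph_def)

lemma num_verts_K311: "num_verts K311 = 5"
  by (simp add: num_verts_def verts_K311)

lemma edge_K311_iff:
  "{i, j} \<in> edges K311 \<longleftrightarrow> i \<in> {0, 1, 2, 3, 4} \<and> j \<in> {0, 1, 2, 3, 4} \<and> i \<noteq> j \<and> \<not> (i \<in> {0, 1, 2} \<and> j \<in> {0, 1, 2})"
  unfolding K311_def edge_complete_partite_graph_iff by auto

lemma edges_K311_E:
  assumes "e \<in> edges K311"
  obtains i j where "e = {i, j}" "i \<in> {0, 1, 2, 3, 4}" "j \<in> {0, 1, 2, 3, 4}"
proof -
  obtain i j where "e = {i, j}"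
    using assms unfolding K311_def complete_partite_graph_def by auto
  then show ?thesis using that assms edge_K311_iff by blast
qed

text \<open>Equality of edge sets becomes a condition on pairs of vertices; injectivity of
  \<open>f\<close> recovers an edge from its image.\<close>

lemma graph_iso_K311_induced_iff:
  assumes G: "is_graph G"
  shows "graph_iso K311 (induced G S) \<longleftrightarrow>
    (\<exists>f. bij_betw f {0, 1, 2, 3, 4} S \<and>
      (\<forall>i\<in>{0, 1, 2, 3, 4}. \<forall>j\<in>{0, 1, 2, 3, 4}. {f i, f j} \<in> edges G \<longleftrightarrow> {i, j} \<in> edges K311))"
    (is "_ \<longleftrightarrow> (\<exists>f. ?B f \<and> ?E f)")
proof -
  have "edges (induced G S) = (`) f ` edges K311 \<longleftrightarrow> ?E f" if f: "?B f" for f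
  proof
    assume eq: "edges (induced G S) = (`) f ` edges K311"
    show "?E f"
    proof (intro ballI iffI)
      fix i j :: nat assume ij: "i \<in> {0, 1, 2, 3, 4}" "j \<in> {0, 1, 2, 3, 4}"
      have fS: "f i \<in> S" "f j \<in> S" using bij_betw_apply[OF f] ij by simp_all
      {
        assume "{f i, f j} \<in> edges G"
        then have "{f i, f j} \<in> (`) f ` edges K311"
          using fS unfolding eq[symmetric] by (simp add: induced_def)
        then obtain e where e: "e \<in> edges K311" "f ` e = f ` {i, j}" by auto
        have "e \<subseteq> {0, 1, 2, 3, 4}" using e(1) by (auto elim: edges_K311_E)
        then have "e = {i, j}"
          using e(2) ij f by (subst (asm) inj_on_image_eq_iff[of f "{0, 1, 2, 3, 4}"]) (auto simp: bij_betw_def)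
        then show "{i, j} \<in> edges K311" using e by simp
      next
        assume "{i, j} \<in> edges K311"
        then have "f ` {i, j} \<in> edges (induced G S)" unfolding eq by (rule imageI)
        then show "{f i, f j} \<in> edges G" by (simp add: induced_def)
      }
    qed
  next
    assume E: "?E f"
    show "edges (induced G S) = (`) f ` edges K311"
    proof (intro equalityI subsetI)
      fix e assume "e \<in> edges (induced G S)"
      then have e: "e \<in> edges G" "e \<subseteq> S" by (auto simp: induced_def)
      then obtain x y where xy: "e = {x, y}" using G by (auto simp: is_graph_def card_2_iff)
      have im: "f ` {0, 1, 2, 3, 4} = S" using f by (rule bij_betw_imp_surj_on)
      have xy': "x \<in> f ` {0, 1, 2, 3, 4}" "y \<in> f ` {0, 1, 2, 3, 4}" using e(2) xy unfolding im by simp_all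
      obtain i where i: "x = f i" "i \<in> {0, 1, 2, 3, 4}" using xy'(1) by (rule imageE)
      obtain j where j: "y = f j" "j \<in> {0, 1, 2, 3, 4}" using xy'(2) by (rule imageE)
      note ij = i j
      have "{f i, f j} \<in> edges G" using e(1) xy ij by simp
      then have "{i, j} \<in> edges K311" using E[THEN bspec, OF ij(2), THEN bspec, OF ij(4)] by simp
      then show "e \<in> (`) f ` edges K311" using xy ij(1,3) by (intro image_eqI[of _ _ "{i, j}"]) simp_all
    next
      fix e assume "e \<in> (`) f ` edges K311"
      then obtain e' where e': "e' \<in> edges K311" "e = f ` e'" by blast
      obtain i j where ij: "e' = {i, j}" "i \<in> {0, 1, 2, 3, 4}" "j \<in> {0, 1, 2, 3, 4}"
        using edges_K311_E[OF e'(1)] by blast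
      then have "{f i, f j} \<in> edges G"
        using E[THEN bspec, OF ij(2), THEN bspec, OF ij(3)] e'(1) by simp
      then have "e \<in> edges G" using e'(2) ij(1) by simp
      moreover have "e \<subseteq> S"
        using e'(2) ij bij_betw_apply[OF f, of i] bij_betw_apply[OF f, of j] by simp
      ultimately show "e \<in> edges (induced G S)" by (simp add: induced_def)
    qed
  qed
  moreover have "verts (induced G S) = S" by (simp add: induced_def)
  ultimately show ?thesis unfolding graph_iso_def verts_K311 by metis
qed

text \<open>The independent vertices 0, 1, 2 of \<open>K311\<close> correspond to \<open>T\<close>,
  the universal vertices 3, 4 to \<open>U\<close>.\<close>

lemma graph_iso_K311_iff_copies:
  assumes G: "is_graph G" and S: "S \<subseteq> verts G"
  shows "graph_iso K311 (induced G S) \<longleftrightarrow> (\<exists>T U. (T, U) \<in> copies (nonadj G) (verts G) \<and> S = T \<union> U)"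
  unfolding graph_iso_K311_induced_iff[OF G]
proof
  assume "\<exists>f. bij_betw f {0, 1, 2, 3, 4} S \<and>
      (\<forall>i\<in>{0, 1, 2, 3, 4}. \<forall>j\<in>{0, 1, 2, 3, 4}. {f i, f j} \<in> edges G \<longleftrightarrow> {i, j} \<in> edges K311)"
  then obtain f where f: "bij_betw f {0, 1, 2, 3, 4} S"
    and E: "\<And>i j. i \<in> {0, 1, 2, 3, 4} \<Longrightarrow> j \<in> {0, 1, 2, 3, 4} \<Longrightarrow> {f i, f j} \<in> edges G \<longleftrightarrow> {i, j} \<in> edges K311"
    by blast
  have inj: "inj_on f {0, 1, 2, 3, 4}" and im: "f ` {0, 1, 2, 3, 4} = S"
    using f by (auto simp: bij_betw_def)
  define T where "T = f ` {0, 1, 2}"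
  define U where "U = f ` {3, 4}"
  have "card T = card {0, 1, 2 :: nat}" "card U = card {3, 4 :: nat}"
    unfolding T_def U_def by (intro card_image inj_on_subset[OF inj]; simp)+
  then have c: "card T = 3" "card U = 2" by simp_all
  have "f ` ({0, 1, 2} \<inter> {3, 4}) = T \<inter> U"
    unfolding T_def U_def by (rule inj_on_image_Int[OF inj]) auto
  then have TU: "T \<inter> U = {}" by simp
  have "{0, 1, 2, 3, 4} = {0, 1, 2} \<union> {3, 4 :: nat}" by auto
  then have STU: "S = T \<union> U" unfolding T_def U_def im[symmetric] by (metis image_Un)
  have "nonadj G x y" if "x \<in> T" "y \<in> T" for x y
  proof -
    obtain i where i: "x = f i" "i \<in> {0, 1, 2}" using \<open>x \<in> T\<close> unfolding T_def by (rule imageE)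
    obtain j where j: "y = f j" "j \<in> {0, 1, 2}" using \<open>y \<in> T\<close> unfolding T_def by (rule imageE)
    have "i \<in> {0, 1, 2, 3, 4}" "j \<in> {0, 1, 2, 3, 4}" using i j by auto
    then show ?thesis using E[of i j] edge_K311_iff[of i j] i j by (simp add: nonadj_def)
  qed
  moreover have "\<not> nonadj G u w" if "u \<in> U" "w \<in> T \<union> U" "w \<noteq> u" for u w
  proof -
    obtain i where i: "u = f i" "i \<in> {3, 4}" using \<open>u \<in> U\<close> unfolding U_def by (rule imageE)
    obtain j where j: "w = f j" "j \<in> {0, 1, 2, 3, 4}"
      using \<open>w \<in> T \<union> U\<close> unfolding STU[symmetric] im[symmetric] by (rule imageE)
    have "i \<in> {0, 1, 2, 3, 4}" "i \<notin> {0, 1, 2}" "i \<noteq> j" using i j \<open>w \<noteq> u\<close> by auto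
    then show ?thesis using E[of i j] edge_K311_iff[of i j] i(1) j by (simp add: nonadj_def)
  qed
  ultimately have "(T, U) \<in> copies (nonadj G) (verts G)"
    using S STU c TU unfolding copies_def by auto
  then show "\<exists>T U. (T, U) \<in> copies (nonadj G) (verts G) \<and> S = T \<union> U" using STU by blast
next
  assume "\<exists>T U. (T, U) \<in> copies (nonadj G) (verts G) \<and> S = T \<union> U"
  then obtain T U where TU: "(T, U) \<in> copies (nonadj G) (verts G)" and STU: "S = T \<union> U" by blast
  note D = copiesD[OF TU]
  obtain a b c where T: "T = {a, b, c}" "a \<noteq> b" "a \<noteq> c" "b \<noteq> c" using D(3) by (auto simp: card_3_iff)
  obtain d e where U: "U = {d, e}" "d \<noteq> e" using D(4) by (auto simp: card_2_iff)
  define f where "f i = (if i = 0 then a else if i = 1 then b else if i = 2 then c else if i = 3 then d else e)"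
    for i :: nat
  have f: "f 0 = a" "f (Suc 0) = b" "f 2 = c" "f 3 = d" "f 4 = e" by (auto simp: f_def)
  have dist: "a \<notin> {d, e}" "b \<notin> {d, e}" "c \<notin> {d, e}" using D(5) T U by auto
  have "bij_betw f {0, 1, 2, 3, 4} S"
    unfolding bij_betw_def inj_on_def STU using T U dist by (auto simp: f)
  moreover have "{f i, f j} \<in> edges G \<longleftrightarrow> {i, j} \<in> edges K311"
    if "i \<in> {0, 1, 2, 3, 4}" "j \<in> {0, 1, 2, 3, 4}" for i j
  proof -
    have fT: "f i \<in> T" if "i \<in> {0, 1, 2}" for i using that T by (auto simp: f)
    have fU: "f i \<in> U" if "i \<in> {3, 4}" for i using that U by (auto simp: f)
    have ne: "f i \<noteq> f j" if "i \<noteq> j" using calculation that \<open>i \<in> _\<close> \<open>j \<in> _\<close> by (auto simp: bij_betw_def inj_on_def)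
    have i: "i \<in> {0, 1, 2} \<or> i \<in> {3, 4}" and j: "j \<in> {0, 1, 2} \<or> j \<in> {3, 4}" using that by auto
    then consider "i = j" | "i \<in> {0, 1, 2}" "j \<in> {0, 1, 2}" | "i \<noteq> j" "i \<in> {3, 4}" | "i \<noteq> j" "j \<in> {3, 4}"
      by metis
    then show ?thesis
    proof cases
      case 1
      then show ?thesis using nonadj_refl[OF G, of "f i"] nonadj_def[of G "f i" "f i"] edge_K311_iff[of i j] by simp
    next
      case 2
      then have "nonadj G (f i) (f j)" using D(8) fT by blast
      then show ?thesis using 2 edge_K311_iff[of i j] by (simp add: nonadj_def)
    next
      case 3
      have "i \<notin> {0, 1, 2}" using 3(2) by auto
      then have K: "{i, j} \<in> edges K311" using edge_K311_iff[of i j] that 3(1) by metis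
      have "f j \<in> T \<union> U" using j fT fU by blast
      then have "\<not> nonadj G (f i) (f j)" using D(9)[OF fU[OF 3(2)]] ne 3(1) by metis
      then show ?thesis using K by (simp add: nonadj_def)
    next
      case 4
      have "j \<notin> {0, 1, 2}" using 4(2) by auto
      then have K: "{i, j} \<in> edges K311" using edge_K311_iff[of i j] that 4(1) by metis
      have "f i \<in> T \<union> U" using i fT fU by blast
      then have "\<not> nonadj G (f j) (f i)" using D(9)[OF fU[OF 4(2)]] ne 4(1) by metis
      then show ?thesis using K nonadj_sym[of G "f i" "f j"] by (simp add: nonadj_def)
    qed
  qed
  ultimately show "\<exists>f. bij_betw f {0, 1, 2, 3, 4} S \<and>
      (\<forall>i\<in>{0, 1, 2, 3, 4}. \<forall>j\<in>{0, 1, 2, 3, 4}. {f i, f j} \<in> edges G \<longleftrightarrow> {i, j} \<in> edges K311)" by blast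
qed

lemma induced_count_K311:
  assumes G: "is_graph G"
  shows "induced_count K311 G = card (copies (nonadj G) (verts G))"
proof -
  have "{S. S \<subseteq> verts G \<and> card S = num_verts K311 \<and> graph_iso K311 (induced G S)} =
      (\<lambda>(T, U). T \<union> U) ` copies (nonadj G) (verts G)" (is "?A = ?B")
  proof (intro equalityI subsetI)
    fix S assume "S \<in> ?A"
    then show "S \<in> ?B" using graph_iso_K311_iff_copies[OF G] by force
  next
    fix S assume "S \<in> ?B"
    then obtain T U where TU: "(T, U) \<in> copies (nonadj G) (verts G)" "S = T \<union> U" by auto
    then have "S \<subseteq> verts G" "card S = 5" using card_Un_copies[OF TU(1)] copiesD(1,2)[OF TU(1)] by auto
    then show "S \<in> ?A" using graph_iso_K311_iff_copies[OF G] TU num_verts_K311 by auto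
  qed
  then show ?thesis unfolding induced_count_def by (simp add: card_image inj_on_copies)
qed

definition clique_parts :: "nat set \<Rightarrow> nat set \<Rightarrow> nat set set" where
  "clique_parts V X = insert X ((\<lambda>v. {v}) ` (V - X))"

definition clique_graph :: "nat set \<Rightarrow> nat set \<Rightarrow> graph" where
  "clique_graph V X = complete_partite_graph (clique_parts V X)"

lemma is_graph_if_has_parts:
  assumes "has_parts G \<P>" "finite (verts G)"
  shows "is_graph G"
  unfolding is_graph_def
proof (intro conjI ballI)
  fix e assume e: "e \<in> edges G"
  obtain A B x y where AB: "A \<in> \<P>" "B \<in> \<P>" "A \<noteq> B" "x \<in> A" "y \<in> B" "e = {x, y}"
    using e assms(1) unfolding has_parts_def complete_partite_graph_def by auto
  have part: "partition_on (verts G) \<P>" using assms(1) unfolding has_parts_def by blast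
  then show "e \<subseteq> verts G" using AB by (auto simp: partition_on_def)
  have "A \<inter> B = {}" using part AB by (auto simp: partition_on_def disjoint_def)
  then have "x \<noteq> y" using AB by blast
  then show "card e = 2" using AB(6) by simp
qed (use assms in auto)

lemma nonadj_has_parts:
  assumes G: "has_parts G \<P>" and xy: "x \<in> verts G" "y \<in> verts G"
  shows "nonadj G x y \<longleftrightarrow> (\<exists>A\<in>\<P>. x \<in> A \<and> y \<in> A)"
proof -
  have eq: "G = complete_partite_graph \<P>" and part: "partition_on (verts G) \<P>"
    using G by (auto simp: has_parts_def)
  have UP: "\<Union>\<P> = verts G" and disj: "\<And>A B. A \<in> \<P> \<Longrightarrow> B \<in> \<P> \<Longrightarrow> A \<noteq> B \<Longrightarrow> A \<inter> B = {}"
    using part by (auto simp: partition_on_def disjoint_def)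
  have "nonadj G x y \<longleftrightarrow> \<not> (\<exists>A\<in>\<P>. \<exists>B\<in>\<P>. A \<noteq> B \<and> x \<in> A \<and> y \<in> B)"
    unfolding nonadj_def by (subst eq) (simp only: edge_complete_partite_graph_iff)
  also have "\<dots> \<longleftrightarrow> (\<exists>A\<in>\<P>. x \<in> A \<and> y \<in> A)"
  proof -
    obtain A B where AB: "A \<in> \<P>" "x \<in> A" "B \<in> \<P>" "y \<in> B" using xy UP by blast
    have "C = A" if "C \<in> \<P>" "x \<in> C" for C using disj[OF that(1) AB(1)] that(2) AB(2) by blast
    moreover have "C = B" if "C \<in> \<P>" "y \<in> C" for C using disj[OF that(1) AB(3)] that(2) AB(4) by blast
    ultimately show ?thesis using AB by metis
  qed
  finally show ?thesis .
qed

text \<open>Parts are nonempty, so \<open>X\<close> must be; this is why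
  \<open>improve_closeness\<close> and \<open>relation_stability\<close> also deliver
  \<open>X \<noteq> {}\<close>.\<close>

lemma clique_graph:
  assumes V: "finite V" "X \<subseteq> V" "X \<noteq> {}"
  shows "verts (clique_graph V X) = V" "has_parts (clique_graph V X) (clique_parts V X)"
    "is_graph (clique_graph V X)"
    "\<And>x y. x \<in> V \<Longrightarrow> y \<in> V \<Longrightarrow> nonadj (clique_graph V X) x y \<longleftrightarrow> clique_rel X x y"
proof -
  have UP: "\<Union>(clique_parts V X) = V" using V by (auto simp: clique_parts_def)
  then show vs: "verts (clique_graph V X) = V" by (simp add: clique_graph_def complete_partite_graph_def)
  have "partition_on V (clique_parts V X)"
    unfolding partition_on_def UP using V by (auto simp: clique_parts_def disjoint_def)
  then show parts: "has_parts (clique_graph V X) (clique_parts V X)"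
    unfolding has_parts_def vs by (simp add: clique_graph_def)
  then show "is_graph (clique_graph V X)" by (rule is_graph_if_has_parts) (simp add: vs V)
  fix x y assume "x \<in> V" "y \<in> V"
  then show "nonadj (clique_graph V X) x y \<longleftrightarrow> clique_rel X x y"
    using nonadj_has_parts[OF parts, of x y] by (auto simp: vs clique_parts_def clique_rel_def)
qed

lemma induced_count_clique_graph:
  assumes V: "finite V" "X \<subseteq> V" "X \<noteq> {}"
  shows "induced_count K311 (clique_graph V X) = card (copies (clique_rel X) V)"
  using induced_count_K311[OF clique_graph(3)[OF V]] clique_graph(1)[OF V]
    copies_cong_on[of V "nonadj (clique_graph V X)" "clique_rel X"] clique_graph(4)[OF V] by simp

section \<open>Edit distance\<close>

lemma finite_edges: "is_graph G \<Longrightarrow> finite (edges G)"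
  by (rule finite_subset[of _ "Pow (verts G)"]) (auto simp: is_graph_def)

lemma edit_dist_le:
  assumes G: "is_graph G" and H: "is_graph H" and eq: "verts H = verts G"
  shows "edit_dist G H \<le> 2 / (real (num_verts G))\<^sup>2 * real (card (sym_diff (edges H) (edges G)))"
proof -
  let ?A = "{card (sym_diff (edges H) ((`) \<sigma> ` edges G)) | \<sigma>. bij_betw \<sigma> (verts G) (verts H)}"
  note fin = finite_edges[OF G] finite_edges[OF H]
  have "?A \<subseteq> {..card (edges H) + card (edges G)}"
  proof clarsimp
    fix \<sigma> :: "nat \<Rightarrow> nat"
    have "card (sym_diff (edges H) ((`) \<sigma> ` edges G)) \<le> card (edges H \<union> (`) \<sigma> ` edges G)"
      using fin by (intro card_mono) auto
    also have "\<dots> \<le> card (edges H) + card ((`) \<sigma> ` edges G)" by (rule card_Un_le)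
    also have "\<dots> \<le> card (edges H) + card (edges G)" using fin by (intro add_left_mono card_image_le)
    finally show "card (sym_diff (edges H) ((`) \<sigma> ` edges G)) \<le> card (edges H) + card (edges G)" .
  qed
  then have "finite ?A" by (rule finite_subset) simp
  moreover have "card (sym_diff (edges H) (edges G)) \<in> ?A"
    using eq by (intro CollectI exI[of _ id]) simp
  ultimately have "Min ?A \<le> card (sym_diff (edges H) (edges G))" by (rule Min_le)
  then show ?thesis unfolding edit_dist_def by (intro mult_left_mono) auto
qed

text \<open>Crude, but enough for graphs whose density is bounded away from the maximum, where the
  stability constant absorbs it.\<close>

lemma edit_dist_le_1:
  assumes G: "is_graph G" and H: "is_graph H" and eq: "verts H = verts G"
  shows "edit_dist G H \<le> 1"
proof (cases "num_verts G = 0")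
  case True
  then show ?thesis by (simp add: edit_dist_def)
next
  case False
  have fin: "finite (verts G)" using G by (simp add: is_graph_def)
  have "card (sym_diff (edges H) (edges G)) \<le> card {e. e \<subseteq> verts G \<and> card e = 2}"
    using G H fin by (intro card_mono) (auto simp: is_graph_def eq)
  also have "\<dots> = num_verts G choose 2" using fin by (simp add: n_subsets num_verts_def)
  finally have "real (card (sym_diff (edges H) (edges G))) \<le> real (num_verts G choose 2)" by simp
  also have "\<dots> \<le> (real (num_verts G))\<^sup>2 / 2"
    by (simp add: real_choose_2 power2_eq_square mult_left_mono)
  finally have "2 / (real (num_verts G))\<^sup>2 * real (card (sym_diff (edges H) (edges G))) \<le>
      2 / (real (num_verts G))\<^sup>2 * ((real (num_verts G))\<^sup>2 / 2)"
    by (intro mult_left_mono) auto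
  also have "\<dots> = 1" using False by simp
  finally show ?thesis using edit_dist_le[OF assms] by linarith
qed

lemma edit_dist_clique_graph_le:
  assumes G: "is_graph G" and X: "X \<subseteq> verts G" "X \<noteq> {}"
  shows "edit_dist G (clique_graph (verts G) X) \<le>
    2 / (real (num_verts G))\<^sup>2 * real (card (bad (nonadj G) X (verts G)))"
proof -
  let ?V = "verts G" and ?H = "clique_graph (verts G) X"
  have V: "finite ?V" using G by (simp add: is_graph_def)
  note H = clique_graph[OF V X]
  have "sym_diff (edges ?H) (edges G) \<subseteq> (\<lambda>(x, y). {x, y}) ` bad (nonadj G) X ?V"
  proof
    fix e assume e: "e \<in> sym_diff (edges ?H) (edges G)"
    then have "e \<subseteq> ?V" "card e = 2" using G H(1,3) by (auto simp: is_graph_def)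
    then obtain x y where xy: "e = {x, y}" "x \<in> ?V" "y \<in> ?V" by (auto simp: card_2_iff)
    then have "nonadj G x y \<noteq> nonadj ?H x y" using e by (auto simp: nonadj_def)
    then have "(x, y) \<in> bad (nonadj G) X ?V" using xy H(4) by (simp add: bad_def)
    then show "e \<in> (\<lambda>(x, y). {x, y}) ` bad (nonadj G) X ?V" using xy by (intro image_eqI[of _ _ "(x, y)"]) auto
  qed
  then have "card (sym_diff (edges ?H) (edges G)) \<le> card (bad (nonadj G) X ?V)"
    by (rule card_image_tuples_le[OF finite_bad[OF V] order_refl])
  then have "2 / (real (num_verts G))\<^sup>2 * real (card (sym_diff (edges ?H) (edges G))) \<le>
    2 / (real (num_verts G))\<^sup>2 * real (card (bad (nonadj G) X ?V))"
    by (intro mult_left_mono) auto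
  then show ?thesis using edit_dist_le[OF G H(3) H(1)] by linarith
qed

subsection \<open>Limits\<close>

lemma real_choose_5:
  "real (m choose 5) = real m * (real m - 1) * (real m - 2) * (real m - 3) * (real m - 4) / 120"
proof -
  have 4: "real (m choose 4) = real m * (real m - 1) * (real m - 2) * (real m - 3) / 24" for m
  proof (induction m)
    case (Suc m)
    have "Suc m choose 4 = (m choose 3) + (m choose 4)" by (simp add: eval_nat_numeral)
    then show ?case using Suc.IH by (simp add: real_choose_3 field_simps)
  qed simp
  show ?thesis
  proof (induction m)
    case (Suc m)
    have "Suc m choose 5 = (m choose 4) + (m choose 5)" by (simp add: eval_nat_numeral)
    then show ?case using Suc.IH by (simp add: 4 field_simps)
  qed simp
qed

lemma inverse_tendsto_0_if_at_top:
  assumes "filterlim m at_top sequentially"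
  shows "(\<lambda>n. 1 / real (m n)) \<longlonglongrightarrow> 0"
  using filterlim_compose[OF lim_1_over_n assms] by simp

lemma choose_5_scaled:
  assumes "m > 0"
  defines "i \<equiv> 1 / real m"
  shows "real (m choose 5) = real m ^ 5 / 120 * ((1 - i) * (1 - 2 * i) * (1 - 3 * i) * (1 - 4 * i))"
proof -
  have e: "real m - 1 = real m * (1 - i)" "real m - 2 = real m * (1 - 2 * i)"
    "real m - 3 = real m * (1 - 3 * i)" "real m - 4 = real m * (1 - 4 * i)"
    using assms by (simp_all add: i_def field_simps)
  show ?thesis unfolding real_choose_5 e by (simp add: eval_nat_numeral)
qed

lemma pow5_over_choose_5_tendsto:
  assumes m: "filterlim m at_top sequentially"
  shows "(\<lambda>n. real (m n) ^ 5 / real (m n choose 5)) \<longlonglongrightarrow> 120"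
proof -
  define i where "i n = 1 / real (m n)" for n
  have i: "i \<longlonglongrightarrow> 0" unfolding i_def by (rule inverse_tendsto_0_if_at_top[OF m])
  have "(\<lambda>n. 120 / ((1 - i n) * (1 - 2 * i n) * (1 - 3 * i n) * (1 - 4 * i n))) \<longlonglongrightarrow>
      120 / ((1 - 0) * (1 - 2 * 0) * (1 - 3 * 0) * (1 - 4 * 0))"
    by (intro tendsto_intros i) auto
  moreover have "\<forall>\<^sub>F n in sequentially. m n \<ge> 1" using m by (simp add: filterlim_at_top)
  then have "\<forall>\<^sub>F n in sequentially. 120 / ((1 - i n) * (1 - 2 * i n) * (1 - 3 * i n) * (1 - 4 * i n)) =
      real (m n) ^ 5 / real (m n choose 5)"
    by eventually_elim (simp add: choose_5_scaled i_def)
  ultimately show ?thesis by (auto elim: Lim_transform_eventually)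
qed

text \<open>The factor 10 is 5! / (3! 2!).\<close>

lemma clique_density_tendsto:
  assumes m: "filterlim m at_top sequentially" and am: "\<And>n. a n \<le> m n"
    and y: "(\<lambda>n. real (a n) / real (m n)) \<longlonglongrightarrow> y"
  shows "(\<lambda>n. real ((a n choose 3) * (m n - a n choose 2)) / real (m n choose 5)) \<longlonglongrightarrow>
    10 * (y ^ 3 * (1 - y)\<^sup>2)"
proof -
  define i where "i n = 1 / real (m n)" for n
  define x where "x n = real (a n) / real (m n)" for n
  have i: "i \<longlonglongrightarrow> 0" unfolding i_def by (rule inverse_tendsto_0_if_at_top[OF m])
  have x: "x \<longlonglongrightarrow> y" unfolding x_def by (rule y)
  have "(\<lambda>n. (x n * (x n - i n) * (x n - 2 * i n) * ((1 - x n) * (1 - x n - i n))) / 12 *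
      (real (m n) ^ 5 / real (m n choose 5))) \<longlonglongrightarrow>
      (y * (y - 0) * (y - 2 * 0) * ((1 - y) * (1 - y - 0))) / 12 * 120"
    by (intro tendsto_intros i x pow5_over_choose_5_tendsto[OF m]) auto
  moreover have "\<forall>\<^sub>F n in sequentially. m n \<ge> 1" using m by (simp add: filterlim_at_top)
  then have "\<forall>\<^sub>F n in sequentially. (x n * (x n - i n) * (x n - 2 * i n) * ((1 - x n) * (1 - x n - i n))) / 12 *
      (real (m n) ^ 5 / real (m n choose 5)) =
      real ((a n choose 3) * (m n - a n choose 2)) / real (m n choose 5)"
  proof eventually_elim
    case (elim n)
    define M where "M = real (m n)"
    have M: "M > 0" using elim by (simp add: M_def)
    have e: "real (m n - a n) = M * (1 - x n)" "real (a n) = M * x n"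
      using am[of n] M by (simp_all add: M_def x_def of_nat_diff field_simps)
    have 1: "1 = M * i n" "2 = M * (2 * i n)" using M by (simp_all add: i_def M_def)
    have f: "M * x n - 1 = M * (x n - i n)" "M * x n - 2 = M * (x n - 2 * i n)"
      "M * (1 - x n) - 1 = M * (1 - x n - i n)"
      using 1 by (simp_all add: algebra_simps)
    have num: "real ((a n choose 3) * (m n - a n choose 2)) =
      M ^ 5 * ((x n * (x n - i n) * (x n - 2 * i n) * ((1 - x n) * (1 - x n - i n))) / 12)"
      unfolding of_nat_mult real_choose_3 real_choose_2 e f by (simp add: eval_nat_numeral)
    show ?case unfolding num M_def by simp
  qed
  ultimately have "(\<lambda>n. real ((a n choose 3) * (m n - a n choose 2)) / real (m n choose 5)) \<longlonglongrightarrow>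
      (y * (y - 0) * (y - 2 * 0) * ((1 - y) * (1 - y - 0))) / 12 * 120"
    by (auto elim: Lim_transform_eventually)
  moreover have "(y * (y - 0) * (y - 2 * 0) * ((1 - y) * (1 - y - 0))) / 12 * 120 = 10 * (y ^ 3 * (1 - y)\<^sup>2)"
    by (simp add: power3_eq_cube power2_eq_square)
  ultimately show ?thesis by metis
qed

lemma induced_count_K311_le:
  assumes "is_graph G"
  shows "real (induced_count K311 G) \<le> 9 / 3125 * real (num_verts G) ^ 5"
  unfolding induced_count_K311[OF assms] num_verts_def
  by (rule card_copies_le) (use assms in \<open>auto simp: is_graph_def nonadj_refl nonadj_sym\<close>)

text \<open>For positive \<open>n\<close> there are infinitely many graphs of order
  \<open>n\<close>, their vertices being arbitrary naturals; \<open>Max\<close> is meaningful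
  because the counts are bounded.\<close>

lemma finite_induced_counts: "finite (induced_count F ` graphs_of_order n)"
proof (rule finite_subset)
  show "induced_count F ` graphs_of_order n \<subseteq> {..n choose num_verts F}"
  proof clarsimp
    fix V E assume G: "(V, E) \<in> graphs_of_order n"
    then have V: "finite V" "card V = n" by (auto simp: graphs_of_order_def is_graph_def num_verts_def)
    have "induced_count F (V, E) \<le> card {S. S \<subseteq> V \<and> card S = num_verts F}"
      unfolding induced_count_def using V by (intro card_mono) auto
    then show "induced_count F (V, E) \<le> n choose num_verts F" using V by (simp add: n_subsets)
  qed
qed simp

lemma graphs_of_order_nonempty: "graphs_of_order n \<noteq> {}"
proof -
  have "({..<n}, {}) \<in> graphs_of_order n" by (simp add: graphs_of_order_def is_graph_def num_verts_def)
  then show ?thesis by blast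
qed

lemma induced_count_le_max: "G \<in> graphs_of_order n \<Longrightarrow> induced_count F G \<le> max_induced_count F n"
  unfolding max_induced_count_def by (intro Max_ge finite_induced_counts) auto

lemma param_max_induced_density:
  "param_max (induced_density F) n = real (max_induced_count F n) / real (n choose num_verts F)"
proof -
  define f where "f k = real k / real (n choose num_verts F)" for k :: nat
  have "mono f" by (auto simp: mono_def f_def divide_right_mono)
  have "induced_density F ` graphs_of_order n = f ` induced_count F ` graphs_of_order n"
    unfolding image_image by (intro image_cong refl) (auto simp: induced_density_def f_def graphs_of_order_def)
  then show ?thesis
    unfolding param_max_def max_induced_count_def f_def[symmetric]
    using mono_Max_commute[OF \<open>mono f\<close> finite_induced_counts[of F n]] graphs_of_order_nonempty[of n] by simp
qed

lemma max_induced_count_K311_le: "real (max_induced_count K311 n) \<le> 9 / 3125 * real n ^ 5"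
proof -
  have "max_induced_count K311 n \<in> induced_count K311 ` graphs_of_order n"
    unfolding max_induced_count_def
    by (intro Max_in finite_induced_counts) (simp add: graphs_of_order_nonempty)
  then obtain G where "G \<in> graphs_of_order n" "max_induced_count K311 n = induced_count K311 G" by blast
  then show ?thesis using induced_count_K311_le[of G] by (auto simp: graphs_of_order_def)
qed

text \<open>The lower bound comes from the model with \<open>3 * n div 5\<close> independent
  vertices, the upper bound from 9/3125 n^5, which holds for every order.\<close>

lemma max_density_K311_tendsto:
  "(\<lambda>n. real (max_induced_count K311 n) / real (n choose 5)) \<longlonglongrightarrow> 216 / 625"
proof (rule tendsto_sandwich)
  define a where "a n = 3 * n div 5" for n :: nat
  have id: "filterlim (\<lambda>n::nat. n) at_top sequentially" by (rule filterlim_ident)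
  have a_n: "a n \<le> n" for n by (simp add: a_def)
  have "(\<lambda>n. real (a n) / real n) \<longlonglongrightarrow> 3 / 5"
  proof (rule tendsto_sandwich)
    have "real (a n) \<ge> 3 / 5 * real n - 1" for n
    proof -
      have "3 * n \<le> 5 * a n + 5" unfolding a_def by presburger
      then have "real (3 * n) \<le> real (5 * a n + 5)" by (rule of_nat_mono)
      then show ?thesis by simp
    qed
    then have "real (a n) / real n \<ge> (3 / 5 * real n - 1) / real n" for n by (intro divide_right_mono) auto
    moreover have "(3 / 5 * real n - 1) / real n = 3 / 5 - 1 / real n" if "n \<ge> 1" for n
      using that by (simp add: field_simps)
    ultimately show "\<forall>\<^sub>F n in sequentially. 3 / 5 - 1 / real n \<le> real (a n) / real n"
      by (intro eventually_sequentiallyI[of 1]) metis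
    have "real (a n) \<le> 3 / 5 * real n" for n
    proof -
      have "5 * a n \<le> 3 * n" unfolding a_def by presburger
      then have "real (5 * a n) \<le> real (3 * n)" by (rule of_nat_mono)
      then show ?thesis by simp
    qed
    then show "\<forall>\<^sub>F n in sequentially. real (a n) / real n \<le> 3 / 5"
      by (intro eventually_sequentiallyI[of 1]) (simp add: divide_le_eq)
    have "(\<lambda>n. 3 / 5 - 1 / real n) \<longlonglongrightarrow> 3 / 5 - 0" by (intro tendsto_intros lim_1_over_n)
    then show "(\<lambda>n. 3 / 5 - 1 / real n) \<longlonglongrightarrow> 3 / 5" by simp
  qed simp
  from clique_density_tendsto[OF id a_n this]
  show "(\<lambda>n. real ((a n choose 3) * (n - a n choose 2)) / real (n choose 5)) \<longlonglongrightarrow> 216 / 625"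
    by (simp add: power3_eq_cube power2_eq_square)
  show "\<forall>\<^sub>F n in sequentially. real ((a n choose 3) * (n - a n choose 2)) / real (n choose 5) \<le>
      real (max_induced_count K311 n) / real (n choose 5)"
  \<comment> \<open>From \<open>n = 2\<close> on, \<open>3 * n div 5\<close> is positive, so the
    model has a nonempty set \<open>X\<close>.\<close>
  proof (rule eventually_sequentiallyI[of 2])
    fix n :: nat assume n: "2 \<le> n"
    have "a n \<ge> 1" unfolding a_def using n by presburger
    then have X: "{..<a n} \<subseteq> {..<n}" "{..<a n} \<noteq> {}" using a_n[of n] by (auto simp: lessThan_empty_iff)
    note H = clique_graph[OF finite_lessThan X]
    have "clique_graph {..<n} {..<a n} \<in> graphs_of_order n"
      using H by (simp add: graphs_of_order_def num_verts_def)
    from induced_count_le_max[OF this, of K311]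
    have "card (copies (clique_rel {..<a n}) {..<n}) \<le> max_induced_count K311 n"
      by (simp add: induced_count_clique_graph[OF finite_lessThan X])
    also have "card (copies (clique_rel {..<a n}) {..<n}) = (a n choose 3) * (n - a n choose 2)"
      using card_copies_clique_rel[OF finite_lessThan X(1)] X(1) by (simp add: card_Diff_subset)
    finally show "real ((a n choose 3) * (n - a n choose 2)) / real (n choose 5) \<le>
      real (max_induced_count K311 n) / real (n choose 5)"
      by (intro divide_right_mono) (simp_all flip: of_nat_mult)
  qed
  show "\<forall>\<^sub>F n in sequentially. real (max_induced_count K311 n) / real (n choose 5) \<le>
      9 / 3125 * (real n ^ 5 / real (n choose 5))"
    using divide_right_mono[OF max_induced_count_K311_le] by (intro always_eventually) simp
  have "(\<lambda>n. 9 / 3125 * (real n ^ 5 / real (n choose 5))) \<longlonglongrightarrow> 9 / 3125 * 120"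
    by (intro tendsto_intros pow5_over_choose_5_tendsto[OF id])
  then show "(\<lambda>n. 9 / 3125 * (real n ^ 5 / real (n choose 5))) \<longlonglongrightarrow> 216 / 625" by simp
qed

section \<open>Perfect stability\<close>

lemma choose_5_le: "real (n choose 5) \<le> real n ^ 5 / 120"
proof (cases "n \<ge> 5")
  case False
  then show ?thesis by (simp add: binomial_eq_0)
next
  case True
  then have "real n * (real n - 1) * (real n - 2) * (real n - 3) * (real n - 4) \<le>
    real n * real n * real n * real n * real n"
    by (intro mult_mono) auto
  then show ?thesis unfolding real_choose_5 by (simp add: eval_nat_numeral)
qed

text \<open>Graphs far below the maximum are covered by edit distance at most 1 and the size of
  \<open>C\<close>. For the others each ordered wrong pair costs n^3 / 2000 copies, which in terms
  of density and edit distance is a linear bound with factor 2 * 2000 / 120 = 100/3.\<close>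

lemma perfectly_stable_K311: "perfectly_stable (induced_density K311)"
proof -
  define r where "r n = real (max_induced_count K311 n) / real (n choose 5)" for n
  have r: "param_max (induced_density K311) n = r n" for n
    by (simp add: r_def param_max_induced_density num_verts_K311)
  have id: "filterlim (\<lambda>n::nat. n) at_top sequentially" by (rule filterlim_ident)
  have "(\<lambda>n. r n / (real n ^ 5 / real (n choose 5))) \<longlonglongrightarrow> (216 / 625) / 120"
    unfolding r_def by (intro tendsto_divide max_density_K311_tendsto pow5_over_choose_5_tendsto[OF id]) simp
  then have "(\<lambda>n. r n / (real n ^ 5 / real (n choose 5))) \<longlonglongrightarrow> 9 / 3125" by simp
  then have "\<forall>\<^sub>F n in sequentially. r n / (real n ^ 5 / real (n choose 5)) > 9 / 3125 - 1 / (2 * 10 ^ 11)"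
    by (rule order_tendstoD) simp
  then obtain n1 where n1: "\<And>n. n \<ge> n1 \<Longrightarrow> r n / (real n ^ 5 / real (n choose 5)) > 9 / 3125 - 1 / (2 * 10 ^ 11)"
    unfolding eventually_sequentially by blast
  define C where "C = 10 ^ 12 + real n1"
  have C: "C \<ge> 10 ^ 12" "C > 0" by (simp_all add: C_def)
  show ?thesis
    unfolding perfectly_stable_def r
  proof (intro exI[of _ C] conjI allI impI ballI)
    show "C > 0" by fact
    fix n G assume n: "C \<le> real n" and G: "G \<in> graphs_of_order n"
    have n1n: "n \<ge> n1" and n8: "n \<ge> 10 ^ 8" and N: "real n > 0"
    proof -
      have "real n1 \<le> C" by (simp add: C_def)
      then have "real n1 \<le> real n" using n by (rule order_trans)
      have "10 ^ 12 \<le> real n" using C(1) n by (rule order_trans)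
      then show "real n > 0" by (rule less_le_trans[rotated]) simp
      have "real (10 ^ 8) \<le> real n" using \<open>10 ^ 12 \<le> real n\<close> by simp
      then show "10 ^ 8 \<le> n" by (rule of_nat_le_iff[THEN iffD1])
      show "n1 \<le> n" using \<open>real n1 \<le> real n\<close> by simp
    qed
    let ?V = "verts G"
    have gG: "is_graph G" and V: "finite ?V" "card ?V = n" and nv: "num_verts G = n"
      using G by (auto simp: graphs_of_order_def is_graph_def num_verts_def)
    have Vne: "?V \<noteq> {}" using V n8 by auto
    define l where "l = induced_density K311 G"
    have cpos: "real (n choose 5) > 0" using n8 by (simp add: zero_less_binomial_iff)
    have cl: "real (induced_count K311 G) = l * real (n choose 5)"
      using cpos by (simp add: l_def induced_density_def num_verts_K311 nv)
    have H: "clique_graph ?V X \<in> graphs_of_order n" "complete_partite (clique_graph ?V X)"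
      if "X \<subseteq> ?V" "X \<noteq> {}" for X
      using clique_graph[OF V(1) that] V(2)
      by (auto simp: graphs_of_order_def num_verts_def complete_partite_def)
    show "\<exists>H\<in>graphs_of_order n. complete_partite H \<and> edit_dist G H \<le> C * (r n - induced_density K311 G)"
    \<comment> \<open>A density gap of 60 / 10^11 is at most half of n^5 / 10^11 copies, as
      \<open>n choose 5\<close> is at most n^5 / 120. The other half of the admissible deficit is
      spent on the distance of the maximum from its limit, by the choice of
      \<open>n1\<close>.\<close>
    proof (cases "l \<ge> r n - 60 / 10 ^ 11")
      case False
      have "edit_dist G (clique_graph ?V ?V) \<le> 1"
        using clique_graph[OF V(1) _ Vne] by (intro edit_dist_le_1 gG) auto
      also have "1 \<le> C * (60 / 10 ^ 11)" using C by simp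
      also have "\<dots> \<le> C * (r n - l)" using False C by (intro mult_left_mono) auto
      finally show ?thesis using H[of ?V] Vne unfolding l_def by blast
    next
      case True
      have "(9 / 3125 - 1 / (2 * 10 ^ 11)) * real n ^ 5 \<le> r n / (real n ^ 5 / real (n choose 5)) * real n ^ 5"
        using n1[OF n1n] by (intro mult_right_mono) auto
      also have "\<dots> = r n * real (n choose 5)" using N by simp
      also have "\<dots> \<le> (l + 60 / 10 ^ 11) * real (n choose 5)" using True by (intro mult_right_mono) auto
      also have "\<dots> = l * real (n choose 5) + 60 / 10 ^ 11 * real (n choose 5)" by (simp add: algebra_simps)
      also have "\<dots> \<le> l * real (n choose 5) + 60 / 10 ^ 11 * (real n ^ 5 / 120)"
        using choose_5_le[of n] by (intro add_left_mono mult_left_mono) auto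
      finally have "(9 / 3125 - 1 / 10 ^ 11) * real n ^ 5 \<le> l * real (n choose 5)"
        by (simp add: algebra_simps)
      then have "(9 / 3125 - 1 / 10 ^ 11) * real (card ?V) ^ 5 \<le> real (card (copies (nonadj G) ?V))"
        using cl by (simp add: induced_count_K311[OF gG] V)
      then obtain X where X: "X \<subseteq> ?V" "X \<noteq> {}"
        and le: "real (card (copies (nonadj G) ?V)) + real (card ?V) ^ 3 * real (card (bad (nonadj G) X ?V)) / 2000
          \<le> real (card (copies (clique_rel X) ?V))"
        using relation_stability[of ?V "nonadj G", OF V(1) _ nonadj_sym nonadj_refl[OF gG]] n8 V(2) by metis
      define D where "D = real (card (bad (nonadj G) X ?V))"
      have "real (card (copies (clique_rel X) ?V)) \<le> r n * real (n choose 5)"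
        using induced_count_le_max[OF H(1)[OF X], of K311] cpos
        by (simp add: induced_count_clique_graph[OF V(1) X] r_def)
      then have "l * real (n choose 5) + real n ^ 3 * D / 2000 \<le> r n * real (n choose 5)"
        using le cl by (simp add: induced_count_K311[OF gG] V D_def)
      then have D1: "real n ^ 3 * D / 2000 \<le> (r n - l) * real (n choose 5)" by (simp add: algebra_simps)
      have "0 \<le> (r n - l) * real (n choose 5)"
        by (rule order_trans[OF _ D1]) (simp add: D_def)
      then have rl: "r n \<ge> l" using cpos by (simp add: zero_le_mult_iff)
      have "real n ^ 3 * D / 2000 \<le> (r n - l) * (real n ^ 5 / 120)"
        using D1 rl choose_5_le[of n] by (meson diff_ge_0_iff_ge mult_left_mono order_trans)
      then have "real n ^ 3 * D \<le> real n ^ 3 * (50 / 3 * (r n - l) * (real n)\<^sup>2)"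
        by (simp add: power2_eq_square eval_nat_numeral algebra_simps)
      then have D2: "D \<le> 50 / 3 * (r n - l) * (real n)\<^sup>2"
        using N by (subst (asm) mult_le_cancel_left_pos) auto
      have "edit_dist G (clique_graph ?V X) \<le> 2 / (real n)\<^sup>2 * D"
        using edit_dist_clique_graph_le[OF gG X] by (simp add: nv D_def)
      also have "\<dots> \<le> 2 / (real n)\<^sup>2 * (50 / 3 * (r n - l) * (real n)\<^sup>2)"
        using D2 by (intro mult_left_mono) auto
      also have "\<dots> = 100 / 3 * (r n - l)" using N by simp
      also have "\<dots> \<le> C * (r n - l)" using C rl by (intro mult_right_mono) auto
      finally show ?thesis using H[OF X] unfolding l_def by blast
    qed
  qed
qed

subsection \<open>Maximisers\<close>

lemma part_size_cases: "finite \<P> \<Longrightarrow> part_size \<P> i = 0 \<or> (\<exists>B\<in>\<P>. part_size \<P> i = card B)"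
proof -
  assume fin: "finite \<P>"
  define s where "s = rev (sorted_list_of_multiset (image_mset card (mset_set \<P>)))"
  have "set s = card ` \<P>" using fin by (simp add: s_def)
  then have "i < length s \<Longrightarrow> s ! i \<in> card ` \<P>" using nth_mem by blast
  then show ?thesis unfolding part_size_def Let_def s_def[symmetric] by auto
qed

text \<open>The sorted list of sizes ends with the largest, so after reversal \<open>card M\<close>
  stands in front and the other indices shift by one. Ties do no harm, since only sizes are
  listed.\<close>

lemma part_size_largest:
  assumes fin: "finite \<P>" and M: "M \<in> \<P>" and max: "\<And>B. B \<in> \<P> \<Longrightarrow> card B \<le> card M"
  shows "part_size \<P> 0 = card M" "part_size \<P> (Suc i) = part_size (\<P> - {M}) i"
proof -
  define A where "A = image_mset card (mset_set (\<P> - {M}))"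
  have "image_mset card (mset_set \<P>) = add_mset (card M) A"
    unfolding A_def using fin M by (simp add: mset_set.remove)
  moreover have "sorted_list_of_multiset (add_mset (card M) A) = sorted_list_of_multiset A @ [card M]"
    using max fin by (simp, intro sorted_insort_is_snoc) (auto simp: A_def)
  ultimately have "rev (sorted_list_of_multiset (image_mset card (mset_set \<P>))) =
      card M # rev (sorted_list_of_multiset A)" by simp
  then show "part_size \<P> 0 = card M" "part_size \<P> (Suc i) = part_size (\<P> - {M}) i"
    unfolding part_size_def A_def[symmetric] by (simp_all add: Let_def)
qed

text \<open>\<open>\<delta>\<close> is the deficit from the optimum of \<open>part_poly\<close>; the
  factors 125/12 and 25 invert the coefficients in \<open>part_poly_stability\<close>. The part
  \<open>M\<close> obtained there exceeds one half of the vertices, so it is the largest and has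
  index 0.\<close>

lemma part_size_stability:
  assumes H: "is_graph H" "has_parts H \<P>" and n: "num_verts H > 0"
    and large: "1 / 32 * real (num_verts H) ^ 5 < 12 * real (induced_count K311 H)"
  defines "\<delta> \<equiv> 108 / 3125 - 12 * real (induced_count K311 H) / real (num_verts H) ^ 5"
  shows "(real (part_size \<P> 0) / real (num_verts H) - 3 / 5)\<^sup>2 \<le> 125 / 12 * \<delta>"
    "(real (part_size \<P> (Suc i)) / real (num_verts H))\<^sup>2 \<le> 25 * \<delta>"
proof -
  define m where "m = real (num_verts H)"
  have m: "m > 0" using n by (simp add: m_def)
  have V: "finite (verts H)" "verts H \<noteq> {}" using H n by (auto simp: is_graph_def num_verts_def)
  have P: "partition_on (verts H) \<P>" using H(2) unfolding has_parts_def by blast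
  define x where "x A = real (card A) / real (card (verts H))" for A :: "nat set"
  note le = card_copies_partition_le[OF V P nonadj_has_parts[OF H(2)], folded x_def]
  have finP: "finite \<P>" by (rule finite_elements[OF V(1) P])
  have sum1: "sum x \<P> = 1" by (rule le(3))
  have x0: "0 \<le> x A" for A by (simp add: x_def)
  have "12 * real (induced_count K311 H) / m ^ 5 \<le> part_poly x \<P>"
    using le(1) m by (simp add: induced_count_K311[OF H(1)] m_def num_verts_def field_simps)
  then have f: "108 / 3125 - \<delta> \<le> part_poly x \<P>" unfolding \<delta>_def m_def by simp
  have "1 / 32 < 12 * real (induced_count K311 H) / m ^ 5"
    using large m unfolding m_def[symmetric] by (simp add: field_simps)
  then have "1 / 32 < part_poly x \<P>" using f unfolding \<delta>_def m_def by simp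
  then obtain M where M: "M \<in> \<P>" "1 / 2 < x M" and
    ub: "part_poly x \<P> \<le> 108 / 3125 - 12 / 125 * (x M - 3 / 5)\<^sup>2 - 1 / 25 * (\<Sum>A\<in>\<P> - {M}. (x A)\<^sup>2)"
    using part_poly_stability[OF finP x0 sum1] by blast
  have q0: "0 \<le> (\<Sum>A\<in>\<P> - {M}. (x A)\<^sup>2)" by (simp add: sum_nonneg)
  have "x B \<le> x M" if "B \<in> \<P>" for B
  proof (cases "B = M")
    case False
    then have "x M + x B \<le> sum x \<P>" using sum_mono2[of \<P> "{M, B}" x] finP M that x0 by auto
    then show ?thesis using M sum1 by linarith
  qed simp
  then have max: "card B \<le> card M" if "B \<in> \<P>" for B
    using that m by (simp add: x_def m_def num_verts_def divide_le_cancel)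
  have x_M: "real (part_size \<P> 0) / m = x M"
    by (simp add: part_size_largest(1)[OF finP M(1) max] x_def m_def num_verts_def)
  have "12 / 125 * (x M - 3 / 5)\<^sup>2 \<le> \<delta>" using f ub q0 by linarith
  then show "(real (part_size \<P> 0) / real (num_verts H) - 3 / 5)\<^sup>2 \<le> 125 / 12 * \<delta>"
    unfolding m_def[symmetric] x_M by simp
  have "0 \<le> 12 / 125 * (x M - 3 / 5)\<^sup>2" by simp
  then have q: "(\<Sum>A\<in>\<P> - {M}. (x A)\<^sup>2) \<le> 25 * \<delta>" using f ub by linarith
  have "part_size \<P> (Suc i) = 0 \<or> (\<exists>B\<in>\<P> - {M}. part_size \<P> (Suc i) = card B)"
    using part_size_cases[of "\<P> - {M}" i] finP by (simp add: part_size_largest(2)[OF finP M(1) max])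
  then show "(real (part_size \<P> (Suc i)) / real (num_verts H))\<^sup>2 \<le> 25 * \<delta>"
  proof
    assume "part_size \<P> (Suc i) = 0"
    then show ?thesis using q q0 by simp
  next
    assume "\<exists>B\<in>\<P> - {M}. part_size \<P> (Suc i) = card B"
    then obtain B where B: "B \<in> \<P> - {M}" "part_size \<P> (Suc i) = card B" by blast
    have "(x B)\<^sup>2 \<le> (\<Sum>A\<in>\<P> - {M}. (x A)\<^sup>2)"
      using B(1) finP by (intro member_le_sum[of B "\<P> - {M}" "\<lambda>A. (x A)\<^sup>2"]) auto
    then show ?thesis using q unfolding B(2) x_def num_verts_def by linarith
  qed
qed

lemma param_lim_K311: "param_lim (induced_density K311) = 216 / 625"
  unfolding param_lim_def
proof (rule limI)
  have "param_max (induced_density K311) = (\<lambda>n. real (max_induced_count K311 n) / real (n choose 5))"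
    by (simp add: fun_eq_iff param_max_induced_density num_verts_K311)
  then show "param_max (induced_density K311) \<longlonglongrightarrow> 216 / 625"
    using max_density_K311_tendsto by simp
qed

text \<open>Along the graphs of a maximiser the deficit in \<open>part_size_stability\<close> tends
  to 0, which forces the limit of every part proportion.\<close>

lemma maximiser_K311_unique:
  assumes "maximiser (induced_density K311) x"
  shows "x = (\<lambda>i. if i = 0 then 3 / 5 else 0)"
proof -
  obtain H \<P> where H: "\<And>n. is_graph (H n)" "\<And>n. has_parts (H n) (\<P> n)"
    and m: "filterlim (\<lambda>n. num_verts (H n)) at_top sequentially"
    and lim: "(\<lambda>n. induced_density K311 (H n)) \<longlonglongrightarrow> 216 / 625"
    and ps: "\<And>i. (\<lambda>n. real (part_size (\<P> n) i) / real (num_verts (H n))) \<longlonglongrightarrow> x i"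
    using assms unfolding maximiser_def param_lim_K311 by blast
  define L where "L n = 12 * real (induced_count K311 (H n)) / real (num_verts (H n)) ^ 5" for n
  have "(\<lambda>n. 12 * (induced_density K311 (H n) / (real (num_verts (H n)) ^ 5 / real (num_verts (H n) choose 5))))
      \<longlonglongrightarrow> 12 * ((216 / 625) / 120)"
    by (intro tendsto_intros lim pow5_over_choose_5_tendsto[OF m]) auto
  moreover have big: "\<forall>\<^sub>F n in sequentially. num_verts (H n) \<ge> 5" using m by (simp add: filterlim_at_top)
  then have "\<forall>\<^sub>F n in sequentially.
      12 * (induced_density K311 (H n) / (real (num_verts (H n)) ^ 5 / real (num_verts (H n) choose 5))) = L n"
  proof eventually_elim
    case (elim n)
    then have "num_verts (H n) choose 5 > 0" by (simp add: zero_less_binomial_iff)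
    then show ?case by (simp add: L_def induced_density_def num_verts_K311)
  qed
  ultimately have "L \<longlonglongrightarrow> 12 * ((216 / 625) / 120)" by (rule Lim_transform_eventually)
  then have L: "L \<longlonglongrightarrow> 108 / 3125" by simp
  then have "\<forall>\<^sub>F n in sequentially. L n > 1 / 32" by (rule order_tendstoD) simp
  then have ev: "\<forall>\<^sub>F n in sequentially.
      (real (part_size (\<P> n) 0) / real (num_verts (H n)) - 3 / 5)\<^sup>2 \<le> 125 / 12 * (108 / 3125 - L n) \<and>
      (\<forall>i. (real (part_size (\<P> n) (Suc i)) / real (num_verts (H n)))\<^sup>2 \<le> 25 * (108 / 3125 - L n))"
    using big
  proof eventually_elim
    case (elim n)
    then have n: "num_verts (H n) > 0" by simp
    then have "1 / 32 * real (num_verts (H n)) ^ 5 < 12 * real (induced_count K311 (H n))"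
      using elim(1) unfolding L_def by (simp add: field_simps)
    from part_size_stability[OF H(1) H(2) n this] show ?case unfolding L_def by blast
  qed
  have ev0: "\<forall>\<^sub>F n in sequentially.
      (real (part_size (\<P> n) 0) / real (num_verts (H n)) - 3 / 5)\<^sup>2 \<le> 125 / 12 * (108 / 3125 - L n)"
    using ev by eventually_elim blast
  have evS: "\<forall>\<^sub>F n in sequentially.
      (real (part_size (\<P> n) (Suc i)) / real (num_verts (H n)))\<^sup>2 \<le> 25 * (108 / 3125 - L n)" for i
    using ev by eventually_elim blast
  have "(\<lambda>n. 125 / 12 * (108 / 3125 - L n)) \<longlonglongrightarrow> 125 / 12 * (108 / 3125 - 108 / 3125)"
    by (intro tendsto_intros L)
  moreover have "(\<lambda>n. (real (part_size (\<P> n) 0) / real (num_verts (H n)) - 3 / 5)\<^sup>2) \<longlonglongrightarrow> (x 0 - 3 / 5)\<^sup>2"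
    by (intro tendsto_intros ps)
  ultimately have "(x 0 - 3 / 5)\<^sup>2 \<le> 125 / 12 * (108 / 3125 - 108 / 3125)"
    using ev0 by (rule tendsto_le[OF sequentially_bot])
  then have x0: "x 0 = 3 / 5" by simp
  have xS: "x (Suc i) = 0" for i
  proof -
    have "(\<lambda>n. 25 * (108 / 3125 - L n)) \<longlonglongrightarrow> 25 * (108 / 3125 - 108 / 3125)"
      by (intro tendsto_intros L)
    moreover have "(\<lambda>n. (real (part_size (\<P> n) (Suc i)) / real (num_verts (H n)))\<^sup>2) \<longlonglongrightarrow> (x (Suc i))\<^sup>2"
      by (intro tendsto_intros ps)
    ultimately have "(x (Suc i))\<^sup>2 \<le> 25 * (108 / 3125 - 108 / 3125)"
      using evS by (rule tendsto_le[OF sequentially_bot])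
    then show ?thesis by simp
  qed
  show ?thesis
  proof
    fix i show "x i = (if i = 0 then 3 / 5 else 0)" using x0 xS by (cases i) auto
  qed
qed

lemma maximiser_K311: "maximiser (induced_density K311) (\<lambda>i. if i = 0 then 3 / 5 else 0)"
    (is "maximiser _ ?x")
proof -
  \<comment> \<open>Orders divisible by 5 make the proportion exactly 3/5, and \<open>Suc\<close>
    keeps \<open>X n\<close> nonempty.\<close>
  define V where "V n = {..<5 * Suc n}" for n
  define X where "X n = {..<3 * Suc n}" for n
  have VX: "finite (V n)" "X n \<subseteq> V n" "X n \<noteq> {}" for n by (auto simp: V_def X_def lessThan_empty_iff)
  define H where "H n = clique_graph (V n) (X n)" for n
  define \<P> where "\<P> n = clique_parts (V n) (X n)" for n
  note cg = clique_graph[OF VX]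
  have nv: "num_verts (H n) = 5 * Suc n" for n by (simp add: num_verts_def H_def cg(1)) (simp add: V_def)
  have m: "filterlim (\<lambda>n. num_verts (H n)) at_top sequentially"
    unfolding nv by (rule filterlim_subseq) (simp add: strict_mono_def)
  have "?x sums (3 / 5)" using sums_single[of 0 "\<lambda>_. 3 / 5 :: real"] by (simp add: eq_commute)
  then have "summable ?x" "suminf ?x \<le> 1" by (auto simp: sums_iff)
  moreover have "decseq ?x" by (auto simp: decseq_def)
  moreover have "\<forall>n. is_graph (H n) \<and> has_parts (H n) (\<P> n)" using cg by (simp add: H_def \<P>_def)
  moreover have "(\<lambda>n. induced_density K311 (H n)) \<longlonglongrightarrow> param_lim (induced_density K311)"
  proof -
    have "(\<lambda>n. real ((3 * Suc n choose 3) * (5 * Suc n - 3 * Suc n choose 2)) / real (5 * Suc n choose 5))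
      \<longlonglongrightarrow> 10 * ((3 / 5) ^ 3 * (1 - 3 / 5)\<^sup>2)"
    proof (rule clique_density_tendsto)
      show "filterlim (\<lambda>n. 5 * Suc n) at_top sequentially" using m unfolding nv .
      have "real (3 * Suc n) / real (5 * Suc n) = 3 / 5" for n by (simp add: field_simps)
      then show "(\<lambda>n. real (3 * Suc n) / real (5 * Suc n)) \<longlonglongrightarrow> 3 / 5" by (simp only: tendsto_const)
    qed simp
    moreover have "induced_count K311 (H n) = (3 * Suc n choose 3) * (5 * Suc n - 3 * Suc n choose 2)" for n
      unfolding H_def induced_count_clique_graph[OF VX] card_copies_clique_rel[OF VX(1,2)]
      by (simp add: card_Diff_subset[OF finite_subset[OF VX(2,1)] VX(2)]) (simp add: V_def X_def)
    ultimately show ?thesis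
      unfolding param_lim_K311 induced_density_def num_verts_K311 nv by (simp add: power3_eq_cube power2_eq_square)
  qed
  moreover have "(\<lambda>n. real (part_size (\<P> n) i) / real (num_verts (H n))) \<longlonglongrightarrow> ?x i" for i
  proof -
    have fin: "finite (\<P> n)" and M: "X n \<in> \<P> n" for n by (auto simp: \<P>_def clique_parts_def VX)
    have one: "card B = 1" if "B \<in> \<P> n - {X n}" for B n
      using that by (auto simp: \<P>_def clique_parts_def)
    have cX: "card (X n) = 3 * Suc n" for n by (simp add: X_def)
    have max: "card B \<le> card (X n)" if "B \<in> \<P> n" for B n using one[of B n] that cX[of n] by force
    have ps: "part_size (\<P> n) 0 = card (X n)" "part_size (\<P> n) (Suc j) = part_size (\<P> n - {X n}) j" for n j
      by (rule part_size_largest[OF fin M max]; assumption)+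
    show ?thesis
    proof (cases i)
      case 0
      have "real (part_size (\<P> n) 0) / real (num_verts (H n)) = 3 / 5" for n
        unfolding ps(1) cX nv by (simp add: field_simps)
      then show ?thesis by (simp only: 0 tendsto_const refl if_True)
    next
      case (Suc j)
      \<comment> \<open>The remaining parts are singletons, and an index beyond the last part gives
        0.\<close>
      have le: "part_size (\<P> n) (Suc j) \<le> 1" for n
        unfolding ps(2) using part_size_cases[of "\<P> n - {X n}" j] fin one by force
      have "(\<lambda>n. real (part_size (\<P> n) (Suc j)) / real (num_verts (H n))) \<longlonglongrightarrow> 0"
      proof (rule tendsto_sandwich[OF _ _ tendsto_const inverse_tendsto_0_if_at_top[OF m]])
        show "\<forall>\<^sub>F n in sequentially. real (part_size (\<P> n) (Suc j)) / real (num_verts (H n)) \<le> 1 / real (num_verts (H n))"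
          using le by (intro always_eventually allI divide_right_mono) auto
      qed simp
      then show ?thesis using Suc by simp
    qed
  qed
  ultimately show ?thesis unfolding maximiser_def using m by (intro conjI exI[of _ H] exI[of _ \<P>]) auto
qed

theorem theorem1p9:
  "perfectly_stable (induced_density K311) \<and>
   (convergent (\<lambda>n. real (max_induced_count K311 n) / real (n choose num_verts K311)) \<and>
    inducibility K311 = 216 / 625) \<and>
   {x. maximiser (induced_density K311) x} = {\<lambda>i. if i = 0 then 3 / 5 else 0}"
proof (intro conjI)
  show "perfectly_stable (induced_density K311)" by (rule perfectly_stable_K311)
  \<comment> \<open>\<open>inducibility\<close> is a \<open>lim\<close>, which has its intended
    meaning only for a convergent sequence.\<close>
  show "convergent (\<lambda>n. real (max_induced_count K311 n) / real (n choose num_verts K311))"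
    unfolding num_verts_K311 using max_density_K311_tendsto by (rule convergentI)
  show "inducibility K311 = 216 / 625"
    unfolding inducibility_def num_verts_K311 using max_density_K311_tendsto by (rule limI)
  show "{x. maximiser (induced_density K311) x} = {\<lambda>i. if i = 0 then 3 / 5 else 0}"
    using maximiser_K311 maximiser_K311_unique by blast
qed

end
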